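(* Let $0<\nu\le\tfrac12$, $\lambda>0$, $\Lambda>0$. Let $N$ be a homogeneous Poisson process with rate $\Lambda$, independent of the inverse process $\mathcal{L}^\nu$ of $H_1^{2\nu}(t)+(2\lambda)^{1/\nu}H_2^\nu(t)$; let $p_k^\nu(t)=\mathsf{P}\{N(\mathcal{L}^\nu(t))=k\}$ and $G_\nu(u,t)=\sum_{k=0}^\infty u^kp_k^\nu(t)$ for real $u$ with $|u|\le1$. Then $G_\nu$ solves $$\frac{\partial^{2\nu}G_\nu(u,t)}{\partial t^{2\nu}}+2\lambda\frac{\partial^\nu G_\nu(u,t)}{\partial t^\nu}=\Lambda(u-1)G_\nu(u,t),\qquad G_\nu(u,0)=1,$$ (Caputo–Djrbashian derivatives in $t$), and for $u<1$ $$G_\nu(u,t)=\tilde\ell_\nu(\Lambda(1-u),t),$$ where $\tilde\ell_\nu(\gamma,t)=\mathsf{E}e^{-\gamma\mathcal{L}^\nu(t)}$ is given, for $\gamma>0$ with $\gamma\ne\lambda^2$, by $$\tilde\ell_\nu(\gamma,t)=\frac12\left[\left(1+\frac{\lambda}{\sqrt{\lambda^2-\gamma}}\right)E_{\nu,1}(r_1t^\nu)+\left(1-\frac{\lambda}{\sqrt{\lambda^2-\gamma}}\right)E_{\nu,1}(r_2t^\nu)\right],$$ $r_1=-\lambda+\sqrt{\lambda^2-\gamma}$, $r_2=-\lambda-\sqrt{\lambda^2-\gamma}$. In particular, if $\Lambda=\lambda^2$, then for $u<1$, $u\neq0$, $$G_\nu(u,t)=\frac{\sqrt u+1}{2\sqrt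 u}E_{\nu,1}(-\lambda(1-\sqrt u)t^\nu)+\frac{\sqrt u-1}{2\sqrt u}E_{\nu,1}(-\lambda(1+\sqrt u)t^\nu).$$
   Context: For $\beta\in(0,1)$, a stable subordinator $H^{\beta}$ is a nondecreasing Lévy process with $\mathsf{E}e^{-sH^{\beta}(t)}=e^{-ts^{\beta}}$, $s>0$; for $\beta=1$ set $H^1(t)=t$. $H_1^{2\nu}$ and $H_2^\nu$ are independent stable subordinators of orders $2\nu$ and $\nu$. The inverse process is $\mathcal{L}^\nu(t)=\inf\{s>0: H_1^{2\nu}(s)+(2\lambda)^{1/\nu}H_2^\nu(s)\ge t\}$, $t>0$, $\mathcal{L}^\nu(0)=0$. The Caputo–Djrbashian derivative of order $\beta\in(0,1)$ is $\frac{d^{\beta}}{dt^{\beta}}u(t)=\frac{1}{\Gamma(1-\beta)}\int_0^t \frac{u'(s)}{(t-s)^{\beta}}\,ds$; for $\beta=1$ it is the ordinary derivative. $E_{\alpha,\beta}(z)=\sum_{r=0}^\infty \frac{z^r}{\Gamma(\alpha r+\beta)}$ is the two-parameter Mittag-Leffler function, considered as an entire function of $z\in\mathbb{C}$. Square roots of negative numbers are complex square roots; either choice of root may be used, since the expressions are symmetric under changing its sign. *)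

theory Defs
  imports "HOL-Probability.Probability"
begin

text \<open>
  Processes are functions of time and outcome; only times \<open>t \<ge> 0\<close> are meaningful.
\<close>

definition independent_increments :: "'a measure \<Rightarrow> (real \<Rightarrow> 'a \<Rightarrow> real) \<Rightarrow> bool" where
  "independent_increments M X \<longleftrightarrow>
     (\<forall>t :: nat \<Rightarrow> real. 0 \<le> t 0 \<and> mono t \<longrightarrow>
        prob_space.indep_vars M (\<lambda>_. borel)
          (\<lambda>i \<omega>. X (t (Suc i)) \<omega> - X (t i) \<omega>) UNIV)"

definition stationary_increments :: "'a measure \<Rightarrow> (real \<Rightarrow> 'a \<Rightarrow> real) \<Rightarrow> bool" where
  "stationary_increments M X \<longleftrightarrow>
     (\<forall>s\<ge>0. \<forall>h\<ge>0. distr M borel (\<lambda>\<omega>. X (s + h) \<omega> - X s \<omega>)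
        = distr M borel (\<lambda>\<omega>. X h \<omega> - X 0 \<omega>))"

definition cadlag :: "(real \<Rightarrow> real) \<Rightarrow> bool" where
  "cadlag f \<longleftrightarrow> (\<forall>t\<ge>0. continuous (at_right t) f) \<and> (\<forall>t>0. \<exists>l. (f \<longlongrightarrow> l) (at_left t))"

text \<open>
  Stochastic continuity is not listed: it follows from stationarity of the increments
  and right-continuity of the paths.
\<close>

definition levy_process :: "'a measure \<Rightarrow> (real \<Rightarrow> 'a \<Rightarrow> real) \<Rightarrow> bool" where
  "levy_process M X \<longleftrightarrow>
     (\<forall>t\<ge>0. X t \<in> borel_measurable M) \<and>
     (AE \<omega> in M. X 0 \<omega> = 0) \<and>
     independent_increments M X \<and>
     stationary_increments M X \<and>
     (AE \<omega> in M. cadlag (\<lambda>t. X t \<omega>))"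

definition stable_subordinator :: "'a measure \<Rightarrow> real \<Rightarrow> (real \<Rightarrow> 'a \<Rightarrow> real) \<Rightarrow> bool" where
  "stable_subordinator M \<beta> H \<longleftrightarrow>
     (if \<beta> = 1 then \<forall>t\<ge>0. \<forall>\<omega>\<in>space M. H t \<omega> = t
      else levy_process M H \<and>
        (AE \<omega> in M. mono_on {0..} (\<lambda>t. H t \<omega>)) \<and>
        (\<forall>t\<ge>0. \<forall>s>0. prob_space.expectation M (\<lambda>\<omega>. exp (- s * H t \<omega>)) = exp (- t * s powr \<beta>)))"

text \<open>
  The Poisson process is a counting process: the path properties hold for every outcome,
  so that its composition with a random time is again a random variable.
\<close>

definition poisson_process :: "'a measure \<Rightarrow> real \<Rightarrow> (real \<Rightarrow> 'a \<Rightarrow> nat) \<Rightarrow> bool" where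
  "poisson_process M rate N \<longleftrightarrow>
     (\<forall>t\<ge>0. N t \<in> measurable M (count_space UNIV)) \<and>
     (\<forall>\<omega>\<in>space M. N 0 \<omega> = 0 \<and> mono_on {0..} (\<lambda>t. N t \<omega>) \<and>
        (\<forall>t\<ge>0. continuous (at_right t) (\<lambda>t. N t \<omega>))) \<and>
     independent_increments M (\<lambda>t \<omega>. real (N t \<omega>)) \<and>
     (\<forall>s t. 0 \<le> s \<and> s < t \<longrightarrow>
        distr M (count_space UNIV) (\<lambda>\<omega>. N t \<omega> - N s \<omega>)
          = measure_pmf (poisson_pmf (rate * (t - s))))"

definition independent_processes ::
    "'a measure \<Rightarrow> (real \<Rightarrow> 'a \<Rightarrow> real) \<Rightarrow> (real \<Rightarrow> 'a \<Rightarrow> real) \<Rightarrow> bool" where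
  "independent_processes M X Y \<longleftrightarrow>
     prob_space.indep_var M
       (Pi\<^sub>M {0..} (\<lambda>_. borel)) (\<lambda>\<omega>. \<lambda>t\<in>{0..}. X t \<omega>)
       (Pi\<^sub>M {0..} (\<lambda>_. borel)) (\<lambda>\<omega>. \<lambda>t\<in>{0..}. Y t \<omega>)"

text \<open>
  The level \<open>t\<close> is almost surely reached; on the null event where it is not, the infimum of
  the empty set is replaced by \<open>0\<close> because \<open>Inf {}\<close> is an unspecified real.
\<close>

definition inverse_process ::
    "real \<Rightarrow> real \<Rightarrow> (real \<Rightarrow> 'a \<Rightarrow> real) \<Rightarrow> (real \<Rightarrow> 'a \<Rightarrow> real) \<Rightarrow> real \<Rightarrow> 'a \<Rightarrow> real" where
  "inverse_process \<nu> lam H1 H2 t \<omega> =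
     (let S = {s. 0 < s \<and> t \<le> H1 s \<omega> + (2 * lam) powr (1 / \<nu>) * H2 s \<omega>}
      in if t = 0 \<or> S = {} then 0 else Inf S)"

definition state_prob ::
    "'a measure \<Rightarrow> (real \<Rightarrow> 'a \<Rightarrow> nat) \<Rightarrow> (real \<Rightarrow> 'a \<Rightarrow> real) \<Rightarrow> nat \<Rightarrow> real \<Rightarrow> real" where
  "state_prob M N L k t = measure M {\<omega> \<in> space M. N (L t \<omega>) \<omega> = k}"

definition gen_fun ::
    "'a measure \<Rightarrow> (real \<Rightarrow> 'a \<Rightarrow> nat) \<Rightarrow> (real \<Rightarrow> 'a \<Rightarrow> real) \<Rightarrow> real \<Rightarrow> real \<Rightarrow> real" where
  "gen_fun M N L u t = (\<Sum>k. u ^ k * state_prob M N L k t)"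

definition laplace_fun :: "'a measure \<Rightarrow> (real \<Rightarrow> 'a \<Rightarrow> real) \<Rightarrow> real \<Rightarrow> real \<Rightarrow> real" where
  "laplace_fun M L \<gamma> t = prob_space.expectation M (\<lambda>\<omega>. exp (- \<gamma> * L t \<omega>))"

definition caputo_deriv :: "real \<Rightarrow> (real \<Rightarrow> real) \<Rightarrow> real \<Rightarrow> real" where
  "caputo_deriv \<beta> u t =
     (if \<beta> = 1 then deriv u t
      else 1 / Gamma (1 - \<beta>) * (LINT s:{0<..<t}|lborel. deriv u s / (t - s) powr \<beta>))"

text \<open>
  Existence of the derivative. As \<open>t - s\<close> is bounded, integrability of the integrand entails
  that of \<open>u'\<close> on \<open>(0, t)\<close>; with continuity of \<open>u\<close> on \<open>[0, t]\<close> this makes \<open>u\<close> absolutely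
  continuous there. No derivative is required at \<open>0\<close>, where \<open>u'\<close> may blow up.
\<close>

definition caputo_differentiable :: "real \<Rightarrow> (real \<Rightarrow> real) \<Rightarrow> real \<Rightarrow> bool" where
  "caputo_differentiable \<beta> u t \<longleftrightarrow>
     (if \<beta> = 1 then u differentiable (at t)
      else continuous_on {0..t} u \<and> (\<forall>s\<in>{0<..<t}. u differentiable (at s)) \<and>
        set_integrable lborel {0<..<t} (\<lambda>s. deriv u s / (t - s) powr \<beta>))"

definition mittag_leffler :: "real \<Rightarrow> real \<Rightarrow> complex \<Rightarrow> complex" where
  "mittag_leffler \<alpha> \<beta> z = (\<Sum>r. z ^ r / of_real (Gamma (\<alpha> * real r + \<beta>)))"

end

theory Submission
  imports Defs "HOL-Real_Asymp.Real_Asymp"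
begin

text \<open>
  Write \<open>H = H\<^sub>1 + (2\<lambda>)\<^bsup>1/\<nu>\<^esup> H\<^sub>2\<close>. By independence \<open>E exp (-\<mu> H(s)) = exp (-s \<phi>(\<mu>))\<close> with
  \<open>\<phi>(\<mu>) = \<mu>\<^bsup>2\<nu>\<^esup> + 2\<lambda> \<mu>\<^bsup>\<nu>\<^esup>\<close>, and \<open>L\<close> is the first passage time of \<open>H\<close>. The events \<open>L(t) > s\<close> and
  \<open>H(s) < t\<close> agree up to boundary effects, so the Laplace transform in \<open>t\<close> of
  \<open>\<ell>(\<gamma>, t) = E exp (-\<gamma> L(t))\<close> is \<open>\<phi>(\<mu>) / (\<mu> (\<gamma> + \<phi>(\<mu>)))\<close> (\<open>laplace_fun_Laplace\<close>). The boundary effects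
  are handled by watching \<open>H\<close> only on a grid \<open>\<delta>, 2\<delta>, \<dots>\<close>: this traps \<open>\<ell>\<close> between two functions
  with explicit transforms, and the gap closes as \<open>\<delta>\<close> tends to \<open>0\<close>.
  
  With \<open>x = \<mu>\<^bsup>-\<nu>\<^esup>\<close> this transform equals \<open>\<mu>\<^bsup>-1\<^esup> (1 + 2\<lambda> x) / (1 + 2\<lambda> x + \<gamma> x\<^sup>2)\<close>. If \<open>a\<^sub>n\<close> are the Taylor
  coefficients of this rational function of \<open>x\<close>, then the series \<open>\<Sum> a\<^sub>n t\<^bsup>\<nu>n\<^esup> / \<Gamma>(\<nu>n + 1)\<close> has, term by
  term, the same transform (\<open>frac_series_Laplace\<close>). A monotone and a
  continuous function with the same Laplace transform coincide, hence \<open>\<ell>\<close> is that series (\<open>laplace_fun_eq_frac_series\<close>). The rest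
  is read off from the coefficients. They satisfy \<open>a\<^bsub>n+2\<^esub> = -2\<lambda> a\<^bsub>n+1\<^esub> - \<gamma> a\<^sub>n\<close> with \<open>a\<^sub>0 = 1\<close>,
  \<open>a\<^sub>1 = 0\<close>: as Caputo derivatives of orders \<open>\<nu>\<close> and \<open>2\<nu>\<close> shift the coefficients by one and two
  places, this recursion is the fractional equation (\<open>frac_series_relax_equation\<close>), where \<open>a\<^sub>1 = 0\<close>
  removes the term that a derivative of order \<open>2\<nu>\<close> would make singular at \<open>0\<close>. If \<open>\<gamma> \<noteq> \<lambda>\<^sup>2\<close>, solving the
  recursion by the two roots \<open>r\<^sub>1, r\<^sub>2\<close> of \<open>z\<^sup>2 + 2\<lambda> z + \<gamma>\<close> gives the two Mittag-Leffler functions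
  (\<open>frac_series_relax_Mittag_Leffler\<close>). Working with the real coefficients \<open>a\<^sub>n\<close> covers the double
  root \<open>\<gamma> = \<lambda>\<^sup>2\<close>, which the equation for the generating function includes.
  
  Finally \<open>E u\<^bsup>N(s)\<^esup> = exp (-\<Lambda> (1 - u) s)\<close> at fixed times, and independence of \<open>N\<close> and \<open>L\<close> turns this
  into \<open>E u\<^bsup>N(L(t))\<^esup> = \<ell>(\<Lambda> (1 - u), t)\<close> (\<open>poisson_process_at_random_time\<close>).
\<close>

section \<open>Gamma and Beta integrals\<close>

text \<open>
  On \<open>[R, \<infinity>)\<close> the integrand \<open>t\<^bsup>y-1\<^esup> exp (-t)\<close> of Euler's integral is at least \<open>R\<^bsup>y-1\<^esup> exp (-t)\<close>.
  With \<open>R\<close> free, this makes \<open>\<Gamma>(\<nu>n + b)\<close> outgrow every geometric sequence.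
\<close>

lemma Gamma_ge_powr_exp:
  fixes R y :: real
  assumes R: "0 < R" and y: "1 \<le> y"
  shows "R powr (y - 1) * exp (- R) \<le> Gamma y"
proof -
  have G: "((\<lambda>t. t powr (y - 1) / exp t) has_integral Gamma y) {0..}"
    using y by (intro Gamma_integral_real) auto
  have "((\<lambda>t. exp (- 1 * t)) has_integral exp (- 1 * R) / 1) {R..}"
    by (rule has_integral_exp_minus_to_infinity) auto
  then have "((\<lambda>t. R powr (y - 1) * exp (- t)) has_integral R powr (y - 1) * exp (- R)) {R..}"
    by (auto intro: has_integral_mult_right)
  then have "((\<lambda>t. if t \<in> {R..} then R powr (y - 1) * exp (- t) else 0)
      has_integral R powr (y - 1) * exp (- R)) {0..}"
    using R by (subst has_integral_restrict) auto
  from this G show ?thesis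
  proof (rule has_integral_le)
    fix t :: real assume "t \<in> {0..}"
    then show "(if t \<in> {R..} then R powr (y - 1) * exp (- t) else 0) \<le> t powr (y - 1) / exp t"
      using R y by (auto simp: exp_minus divide_inverse intro!: mult_right_mono powr_mono2)
  qed
qed

lemma summable_power_over_Gamma:
  fixes \<nu> b K :: real
  assumes \<nu>: "0 < \<nu>" and b: "0 < b" and K: "0 \<le> K"
  shows "summable (\<lambda>n. K ^ n / Gamma (\<nu> * real n + b))"
proof -
  \<comment> \<open>\<open>R\<close> is chosen such that \<open>R\<^bsup>\<nu>n\<^esup>\<close> beats \<open>K\<^sup>n\<close> by a factor \<open>2\<^sup>n\<close>.\<close>
  define R where "R = (2 * (K + 1)) powr (1 / \<nu>)"
  have R: "0 < R" and R\<nu>: "R powr \<nu> = 2 * (K + 1)"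
    using K \<nu> by (auto simp: R_def powr_powr)
  have "filterlim (\<lambda>n. \<nu> * real n + b) at_top sequentially"
    using \<nu> by real_asymp
  then have "\<forall>\<^sub>F n in sequentially. 1 \<le> \<nu> * real n + b"
    by (simp add: filterlim_at_top)
  then have "\<forall>\<^sub>F n in sequentially. norm (K ^ n / Gamma (\<nu> * real n + b))
      \<le> exp R / R powr (b - 1) * (1 / 2) ^ n"
  proof eventually_elim
    case (elim n)
    let ?y = "\<nu> * real n + b"
    have "R powr (?y - 1) = (R powr \<nu>) ^ n * R powr (b - 1)"
      using R by (simp add: powr_add[symmetric] powr_powr powr_realpow[symmetric] algebra_simps)
    also have "\<dots> = (2 * (K + 1)) ^ n * R powr (b - 1)"
      by (simp add: R\<nu>)
    finally have "(2 * (K + 1)) ^ n * R powr (b - 1) * exp (- R) \<le> Gamma ?y"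
      using Gamma_ge_powr_exp[OF R elim] by simp
    moreover have "(2 * K) ^ n \<le> (2 * (K + 1)) ^ n"
      using K by (intro power_mono) auto
    ultimately have *: "(2 * K) ^ n * (R powr (b - 1) * exp (- R)) \<le> Gamma ?y"
      by (smt (verit) R mult.assoc mult_right_mono exp_gt_zero powr_gt_zero mult_pos_pos)
    have G: "0 < Gamma ?y" using elim by (intro Gamma_real_pos) auto
    define c where "c = R powr (b - 1) * exp (- R)"
    have c: "0 < c" "exp R / R powr (b - 1) = 1 / c"
      using R by (auto simp: c_def exp_minus field_simps)
    have "K ^ n = (2 * K) ^ n * (1 / 2) ^ n"
      by (simp add: power_mult_distrib power_one_over)
    also have "\<dots> \<le> Gamma ?y / c * (1 / 2) ^ n"
      using * c(1) by (intro mult_right_mono) (auto simp: c_def[symmetric] pos_le_divide_eq)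
    finally have "K ^ n / Gamma ?y \<le> (Gamma ?y / c * (1 / 2) ^ n) / Gamma ?y"
      using G by (intro divide_right_mono) auto
    also have "\<dots> = 1 / c * (1 / 2) ^ n" using G by simp
    finally show ?case using K G unfolding c(2) by simp
  qed
  then show ?thesis
    by (rule summable_comparison_test_ev) (intro summable_mult summable_geometric; simp)
qed

text \<open>
  Stated over any normed field: real coefficients occur in the solution of the equation, complex
  ones in the Mittag-Leffler functions.
\<close>

lemma summable_series_over_Gamma:
  fixes a :: "nat \<Rightarrow> 'b::real_normed_field"
  assumes \<nu>: "0 < \<nu>" and b: "0 < b" and a: "\<And>n. norm (a n) \<le> K ^ n"
  shows "summable (\<lambda>n. norm (a n * x ^ n / of_real (Gamma (\<nu> * real n + b))))"
proof (rule summable_comparison_test)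
  have K: "0 \<le> K" using a[of 1] norm_ge_zero[of "a 1"] by (simp del: norm_ge_zero)
  then show "summable (\<lambda>n. (K * norm x) ^ n / Gamma (\<nu> * real n + b))"
    using \<nu> b by (intro summable_power_over_Gamma) auto
  have G: "0 < Gamma (\<nu> * real n + b)" for n
    using \<nu> b by (intro Gamma_real_pos add_nonneg_pos) auto
  show "\<exists>N. \<forall>n\<ge>N. norm (norm (a n * x ^ n / of_real (Gamma (\<nu> * real n + b))))
      \<le> (K * norm x) ^ n / Gamma (\<nu> * real n + b)"
  proof (intro exI[of _ 0] allI impI)
    fix n
    show "norm (norm (a n * x ^ n / of_real (Gamma (\<nu> * real n + b))))
      \<le> (K * norm x) ^ n / Gamma (\<nu> * real n + b)"
      using G[of n] a[of n]
      by (auto simp: norm_mult norm_divide norm_power power_mult_distrib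
          intro!: divide_right_mono mult_right_mono)
  qed
qed

lemma has_bochner_integral_powr_exp:
  fixes b \<mu> :: real
  assumes b: "0 < b" and \<mu>: "0 < \<mu>"
  shows "has_bochner_integral lborel (\<lambda>t. indicator {0<..} t * (exp (- \<mu> * t) * t powr (b - 1)))
     (Gamma b / \<mu> powr b)"
proof -
  have "has_bochner_integral lborel (\<lambda>t. indicator {0..} t * t powr (b - 1) / exp t) (Gamma b)"
  proof (rule has_bochner_integral_nn_integral)
    show "(\<integral>\<^sup>+ t. ennreal (indicator {0..} t * t powr (b - 1) / exp t) \<partial>lborel) = ennreal (Gamma b)"
      using Gamma_conv_nn_integral_real[OF b] by simp
  qed (use b Gamma_real_pos[OF b] in auto)
  then have "has_bochner_integral lborel
      (\<lambda>t. indicator {0..} (\<mu> * t) * (\<mu> * t) powr (b - 1) / exp (\<mu> * t)) (Gamma b / \<mu>)"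
    using \<mu> lborel_has_bochner_integral_real_affine_iff[of \<mu> _ "Gamma b" 0]
    by (simp add: divide_inverse mult.commute)
  then have "has_bochner_integral lborel
      (\<lambda>t. (1 / \<mu> powr (b - 1)) * (indicator {0..} (\<mu> * t) * (\<mu> * t) powr (b - 1) / exp (\<mu> * t)))
      ((1 / \<mu> powr (b - 1)) * (Gamma b / \<mu>))"
    by (rule has_bochner_integral_mult_right)
  moreover have "(1 / \<mu> powr (b - 1)) * (Gamma b / \<mu>) = Gamma b / \<mu> powr b"
    using \<mu> by (simp add: powr_diff field_simps)
  moreover have "(1 / \<mu> powr (b - 1)) * (indicator {0..} (\<mu> * t) * (\<mu> * t) powr (b - 1) / exp (\<mu> * t))
     = indicator {0<..} t * (exp (- \<mu> * t) * t powr (b - 1))" for t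
    using \<mu> by (cases "t > 0") (auto simp: indicator_def powr_mult exp_minus field_simps zero_le_mult_iff)
  ultimately show ?thesis by (simp only:)
qed

lemma has_bochner_integral_Beta_scaled:
  fixes a b t :: real
  assumes a: "0 < a" and b: "0 < b" and t: "0 < t"
  shows "has_bochner_integral lborel
      (\<lambda>s. indicator {0<..<t} s * (s powr (a - 1) * (t - s) powr (b - 1)))
      (Beta a b * t powr (a + b - 1))"
proof -
  have "set_integrable lborel {0..1} (\<lambda>s. s powr (a - 1) * (1 - s) powr (b - 1))"
    using a b by (rule integrable_Beta)
  moreover from this have "(LINT s:{0..1}|lborel. s powr (a - 1) * (1 - s) powr (b - 1)) = Beta a b"
    using has_integral_Beta_real[OF a b]
    by (simp add: set_borel_integral_eq_integral(2) integral_unique)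
  ultimately have "has_bochner_integral lborel
      (\<lambda>s. indicator {0..1} s * (s powr (a - 1) * (1 - s) powr (b - 1))) (Beta a b)"
    by (simp add: has_bochner_integral_iff set_integrable_def set_lebesgue_integral_def)
  then have "has_bochner_integral lborel
      (\<lambda>s. indicator {0..1} (s / t) * ((s / t) powr (a - 1) * (1 - s / t) powr (b - 1))) (t * Beta a b)"
    using t lborel_has_bochner_integral_real_affine_iff[of "1 / t" _ "Beta a b" 0]
    by (simp add: divide_inverse mult.commute)
  then have "has_bochner_integral lborel
      (\<lambda>s. t powr (a + b - 2) *
        (indicator {0..1} (s / t) * ((s / t) powr (a - 1) * (1 - s / t) powr (b - 1))))
      (t powr (a + b - 2) * (t * Beta a b))"
    by (rule has_bochner_integral_mult_right)
  moreover have "t powr (a + b - 2) * (t * Beta a b) = Beta a b * t powr (a + b - 1)"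
    using t powr_add[of t "a + b - 2" 1] by (simp add: mult_ac)
  moreover have "t powr (a + b - 2) *
        (indicator {0..1} (s / t) * ((s / t) powr (a - 1) * (1 - s / t) powr (b - 1)))
     = indicator {0<..<t} s * (s powr (a - 1) * (t - s) powr (b - 1))" for s
  proof (cases "0 < s \<and> s < t")
    case True
    have "1 - s / t = (t - s) / t" using t by (simp add: field_simps)
    moreover have "t powr (a + b - 2) = t powr (a - 1) * t powr (b - 1)"
      by (simp add: powr_add[symmetric])
    ultimately show ?thesis using True by (simp add: powr_divide indicator_def)
  next
    case False
    then show ?thesis using t by (cases "s = 0"; cases "s = t") (auto simp: indicator_def field_simps)
  qed
  ultimately show ?thesis by (simp only:)
qed

section \<open>Power series in a fractional power of time\<close>

text \<open>
  For \<open>a n = z ^ n\<close> this is the Mittag-Leffler function \<open>E\<^bsub>\<nu>,1\<^esub>(z t\<^bsup>\<nu>\<^esup>)\<close>. General coefficients make it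
  possible to treat the combination of two such functions, and its degenerate case of a double root,
  as a single series.
\<close>

definition frac_series :: "real \<Rightarrow> (nat \<Rightarrow> real) \<Rightarrow> real \<Rightarrow> real" where
  "frac_series \<nu> a t = (\<Sum>n. a n * (t powr \<nu>) ^ n / Gamma (\<nu> * real n + 1))"

lemma powr_power_shift:
  fixes t :: real
  assumes "0 < t"
  shows "(t powr \<nu>) ^ n * t powr c = t powr (\<nu> * real n + c)"
  using assms by (simp add: powr_realpow[symmetric] powr_powr powr_add)

context
  fixes \<nu> K :: real and a :: "nat \<Rightarrow> real"
  assumes \<nu>: "0 < \<nu>" and a_bound: "\<And>n. \<bar>a n\<bar> \<le> K ^ n"
begin

lemma growth_rate_nonneg: "0 \<le> K"
  using a_bound[of 1] by simp

lemma summable_frac_series: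
  assumes "0 < b"
  shows "summable (\<lambda>n. \<bar>a n * x ^ n / Gamma (\<nu> * real n + b)\<bar>)"
  using summable_series_over_Gamma[OF \<nu> assms, of a K x] a_bound by simp

lemma summable_frac_series_Suc:
  assumes "0 < b"
  shows "summable (\<lambda>n. \<bar>a (Suc n) * x ^ n / Gamma (\<nu> * real n + b)\<bar>)"
proof (rule summable_comparison_test)
  show "summable (\<lambda>n. K * ((K * \<bar>x\<bar>) ^ n / Gamma (\<nu> * real n + b)))"
    using \<nu> assms growth_rate_nonneg by (intro summable_mult summable_power_over_Gamma) auto
  have G: "0 < Gamma (\<nu> * real n + b)" for n
    using \<nu> assms by (intro Gamma_real_pos add_nonneg_pos) auto
  show "\<exists>N. \<forall>n\<ge>N. norm \<bar>a (Suc n) * x ^ n / Gamma (\<nu> * real n + b)\<bar>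
      \<le> K * ((K * \<bar>x\<bar>) ^ n / Gamma (\<nu> * real n + b))"
  proof (intro exI[of _ 0] allI impI)
    fix n
    have "\<bar>a (Suc n)\<bar> * \<bar>x\<bar> ^ n \<le> K ^ Suc n * \<bar>x\<bar> ^ n"
      by (intro mult_right_mono a_bound) auto
    then have "\<bar>a (Suc n)\<bar> * \<bar>x\<bar> ^ n / Gamma (\<nu> * real n + b)
        \<le> K ^ Suc n * \<bar>x\<bar> ^ n / Gamma (\<nu> * real n + b)"
      using G[of n] by (intro divide_right_mono) auto
    then show "norm \<bar>a (Suc n) * x ^ n / Gamma (\<nu> * real n + b)\<bar>
      \<le> K * ((K * \<bar>x\<bar>) ^ n / Gamma (\<nu> * real n + b))"
      using G[of n] by (simp add: abs_mult power_abs power_mult_distrib mult_ac)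
  qed
qed

lemma frac_series_zero: "frac_series \<nu> a 0 = a 0"
  using powser_zero[of "\<lambda>n. a n / Gamma (\<nu> * real n + 1)"] by (simp add: frac_series_def)

text \<open>
  Differentiation in \<open>x = t\<^bsup>\<nu>\<^esup>\<close> avoids the singularity at \<open>t = 0\<close>: in this variable the series is
  entire. The factor \<open>n + 1\<close> produced by the derivative cancels against the Gamma function,
  which is why the parameter \<open>1\<close> becomes \<open>\<nu>\<close>.
\<close>

lemma frac_series_derivative_power_series:
  "((\<lambda>x. \<Sum>n. a n * x ^ n / Gamma (\<nu> * real n + 1)) has_field_derivative
      (\<Sum>n. a (Suc n) * x ^ n / Gamma (\<nu> * real n + \<nu>)) / \<nu>) (at x)"
proof -
  define c where "c n = a n / Gamma (\<nu> * real n + 1)" for n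
  have "summable (\<lambda>n. c n * y ^ n)" for y
    using summable_rabs_cancel[OF summable_frac_series[of 1 y]] by (simp add: c_def)
  then have "((\<lambda>x. \<Sum>n. c n * x ^ n) has_field_derivative (\<Sum>n. diffs c n * x ^ n)) (at x)"
    by (rule termdiffs_strong_converges_everywhere)
  moreover have "diffs c n * x ^ n = a (Suc n) * x ^ n / Gamma (\<nu> * real n + \<nu>) / \<nu>" for n
  proof -
    have "\<nu> * real (Suc n) \<notin> \<int>\<^sub>\<le>\<^sub>0"
      using \<nu> by (smt (verit) mult_pos_pos nonpos_Ints_nonpos of_nat_0_less_iff zero_less_Suc)
    then have "Gamma (\<nu> * real (Suc n) + 1) = \<nu> * real (Suc n) * Gamma (\<nu> * real (Suc n))"
      by (rule Gamma_plus1)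
    moreover have "\<nu> * real (Suc n) = \<nu> * real n + \<nu>"
      by (simp add: algebra_simps)
    ultimately have "diffs c n = real (Suc n) * a (Suc n) / (\<nu> * real (Suc n) * Gamma (\<nu> * real n + \<nu>))"
      by (simp add: diffs_def c_def del: of_nat_Suc)
    also have "\<dots> = a (Suc n) / Gamma (\<nu> * real n + \<nu>) / \<nu>"
      by (simp add: field_simps del: of_nat_Suc)
    finally show ?thesis by simp
  qed
  moreover have "summable (\<lambda>n. a (Suc n) * x ^ n / Gamma (\<nu> * real n + \<nu>))"
    by (rule summable_rabs_cancel[OF summable_frac_series_Suc[OF \<nu>]])
  ultimately show ?thesis
    by (simp add: c_def suminf_divide[symmetric])
qed

lemma continuous_on_frac_series: "continuous_on {0..} (frac_series \<nu> a)"
proof -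
  let ?P = "\<lambda>x. \<Sum>n. a n * x ^ n / Gamma (\<nu> * real n + 1)"
  have "continuous_on UNIV ?P"
    using frac_series_derivative_power_series
    by (meson DERIV_isCont continuous_at_imp_continuous_on)
  then have "continuous_on {0..} (\<lambda>t. ?P (t powr \<nu>))"
    by (rule continuous_on_compose2) (use \<nu> in \<open>auto intro!: continuous_intros continuous_on_powr'\<close>)
  then show ?thesis by (simp add: frac_series_def[abs_def])
qed

lemma frac_series_has_derivative:
  assumes "0 < t"
  shows "(frac_series \<nu> a has_real_derivative
      t powr (\<nu> - 1) * (\<Sum>n. a (Suc n) * (t powr \<nu>) ^ n / Gamma (\<nu> * real n + \<nu>))) (at t)"
proof -
  have "((\<lambda>t. t powr \<nu>) has_real_derivative \<nu> * t powr (\<nu> - 1)) (at t)"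
    using assms by (rule has_real_derivative_powr)
  from DERIV_chain2[OF frac_series_derivative_power_series this]
  show ?thesis
    using \<nu> unfolding frac_series_def by (simp add: mult_ac)
qed

text \<open>
  Each power \<open>t\<^bsup>\<nu>n\<^esup> / \<Gamma>(\<nu>n + 1)\<close> has the transform \<open>\<mu>\<^bsup>-\<nu>n-1\<^esup>\<close>; the sum and the integral may be
  exchanged as soon as the resulting power series converges absolutely, that is, when the
  growth rate \<open>K\<close> of the coefficients is below \<open>\<mu>\<^bsup>\<nu>\<^esup>\<close>.
\<close>

lemma frac_series_Laplace:
  assumes \<mu>: "0 < \<mu>" and K: "K < \<mu> powr \<nu>"
  shows "has_bochner_integral lborel (\<lambda>t. indicator {0<..} t * (exp (- \<mu> * t) * frac_series \<nu> a t))
           ((\<Sum>n. a n * (\<mu> powr - \<nu>) ^ n) / \<mu>)"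
proof -
  define g where "g n t = a n / Gamma (\<nu> * real n + 1) *
      (indicator {0<..} t * (exp (- \<mu> * t) * t powr (\<nu> * real n)))" for n and t :: real
  have G: "0 < Gamma (\<nu> * real n + 1)" for n
    using \<nu> by (intro Gamma_real_pos add_nonneg_pos) auto
  have I: "has_bochner_integral lborel
      (\<lambda>t. c / Gamma (\<nu> * real n + 1) * (indicator {0<..} t * (exp (- \<mu> * t) * t powr (\<nu> * real n))))
      (c * (\<mu> powr - \<nu>) ^ n / \<mu>)" for n c
  proof -
    have "0 < \<nu> * real n + 1" using \<nu> by (intro add_nonneg_pos) auto
    from has_bochner_integral_mult_right[OF has_bochner_integral_powr_exp[OF this \<mu>], of "c / Gamma (\<nu> * real n + 1)"]
    have "has_bochner_integral lborel
      (\<lambda>t. c / Gamma (\<nu> * real n + 1) * (indicator {0<..} t * (exp (- \<mu> * t) * t powr (\<nu> * real n))))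
      (c / Gamma (\<nu> * real n + 1) * (Gamma (\<nu> * real n + 1) / \<mu> powr (\<nu> * real n + 1)))"
      by simp
    moreover have "c / Gamma (\<nu> * real n + 1) * (Gamma (\<nu> * real n + 1) / \<mu> powr (\<nu> * real n + 1))
        = c * (\<mu> powr - \<nu>) ^ n / \<mu>"
    proof -
      have "\<mu> powr (\<nu> * real n + 1) = (\<mu> powr \<nu>) ^ n * \<mu>"
        using powr_power_shift[OF \<mu>, of \<nu> n 1] \<mu> by simp
      then show ?thesis using G[of n] \<mu> by (simp add: powr_minus power_inverse divide_inverse)
    qed
    ultimately show ?thesis by (simp only:)
  qed
  have norm_g: "norm (g n t) = \<bar>a n\<bar> / Gamma (\<nu> * real n + 1) *
      (indicator {0<..} t * (exp (- \<mu> * t) * t powr (\<nu> * real n)))" for n t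
    using G[of n] by (auto simp: g_def abs_mult indicator_def)
  have g_eq: "g n t = indicator {0<..} t * exp (- \<mu> * t) *
      (a n * (t powr \<nu>) ^ n / Gamma (\<nu> * real n + 1))" for n t
    using powr_power_shift[of t \<nu> n 0] by (auto simp: g_def indicator_def)
  have int: "integrable lborel (g n)" for n
    using I[of "a n" n] by (simp add: g_def[abs_def] has_bochner_integral_iff)
  have sn: "summable (\<lambda>n. norm (g n t))" for t
    unfolding g_eq norm_mult
    by (intro summable_mult) (use summable_frac_series[of 1 "t powr \<nu>"] in simp)
  have "(\<integral>t. norm (g n t) \<partial>lborel) = \<bar>a n\<bar> * (\<mu> powr - \<nu>) ^ n / \<mu>" for n
    unfolding norm_g using I[of "\<bar>a n\<bar>" n] by (simp add: has_bochner_integral_iff)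
  moreover have "summable (\<lambda>n. \<bar>a n\<bar> * (\<mu> powr - \<nu>) ^ n / \<mu>)"
  proof (rule summable_divide, rule summable_comparison_test)
    have "K * \<mu> powr - \<nu> < 1"
      using K \<mu> by (simp add: powr_minus divide_inverse[symmetric] field_simps)
    then show "summable (\<lambda>n. (K * \<mu> powr - \<nu>) ^ n)"
      using growth_rate_nonneg by (intro summable_geometric) (auto simp: abs_mult)
    show "\<exists>N. \<forall>n\<ge>N. norm (\<bar>a n\<bar> * (\<mu> powr - \<nu>) ^ n) \<le> (K * \<mu> powr - \<nu>) ^ n"
      using a_bound by (auto simp: power_mult_distrib abs_mult intro!: mult_right_mono)
  qed
  ultimately have si: "summable (\<lambda>n. \<integral>t. norm (g n t) \<partial>lborel)" by simp
  have "(\<Sum>n. g n t) = indicator {0<..} t * (exp (- \<mu> * t) * frac_series \<nu> a t)" for t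
    unfolding g_eq frac_series_def mult.assoc[symmetric]
    by (rule suminf_mult) (rule summable_rabs_cancel[OF summable_frac_series], simp)
  moreover have "(\<integral>t. g n t \<partial>lborel) = a n * (\<mu> powr - \<nu>) ^ n / \<mu>" for n
    using I[of "a n" n] by (simp add: g_def[abs_def] has_bochner_integral_iff)
  moreover have "summable (\<lambda>n. a n * (\<mu> powr - \<nu>) ^ n)"
  proof -
    have "summable (\<lambda>n. \<bar>a n\<bar> * (\<mu> powr - \<nu>) ^ n / \<mu> * \<mu>)"
      by (intro summable_mult2) fact
    then have "summable (\<lambda>n. \<bar>a n * (\<mu> powr - \<nu>) ^ n\<bar>)"
      using \<mu> by (simp add: abs_mult)
    then show ?thesis by (rule summable_rabs_cancel)
  qed
  ultimately show ?thesis
    using integrable_suminf[OF int _ si] integral_suminf[OF int _ si] sn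
    by (simp add: has_bochner_integral_iff suminf_divide)
qed

text \<open>
  A Beta integral turns the derivative of each term \<open>t\<^bsup>\<nu>n\<^esup> / \<Gamma>(\<nu>n + 1)\<close> with \<open>n \<ge> 1\<close> into
  \<open>t\<^bsup>\<nu>n-\<beta>\<^esup> / \<Gamma>(\<nu>n + 1 - \<beta>)\<close>, and for \<open>\<beta> = 1\<close> the same formula is the ordinary derivative. The
  function \<open>u\<close> has to agree with the series only for nonnegative times, because nothing is known of
  a generating function at negative ones.
\<close>

lemma frac_series_Caputo:
  assumes u: "\<And>s. 0 \<le> s \<Longrightarrow> u s = frac_series \<nu> a s"
    and \<beta>: "0 < \<beta>" "\<beta> \<le> 1" and t: "0 < t"
  shows "caputo_differentiable \<beta> u t"
    and "caputo_deriv \<beta> u t =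
      t powr (\<nu> - \<beta>) * (\<Sum>n. a (Suc n) * (t powr \<nu>) ^ n / Gamma (\<nu> * real n + (\<nu> + 1 - \<beta>)))"
proof -
  have D: "(u has_real_derivative
      s powr (\<nu> - 1) * (\<Sum>n. a (Suc n) * (s powr \<nu>) ^ n / Gamma (\<nu> * real n + \<nu>))) (at s)"
    if "0 < s" for s
    by (rule has_field_derivative_transform_within_open[OF frac_series_has_derivative[OF that], of "{0<..}"])
      (use that u in auto)
  then have diff: "u differentiable at s" if "0 < s" for s
    using that by (meson real_differentiable_def)
  have deriv: "deriv u s = s powr (\<nu> - 1) *
      (\<Sum>n. a (Suc n) * (s powr \<nu>) ^ n / Gamma (\<nu> * real n + \<nu>))" if "0 < s" for s
    using D[OF that] by (rule DERIV_imp_deriv)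
  have cont: "continuous_on {0..t} u"
    using continuous_on_subset[OF continuous_on_frac_series, of "{0..t}"] u
    by (subst continuous_on_cong[OF refl, of _ _ "frac_series \<nu> a"]) auto
  consider "\<beta> = 1" | "\<beta> < 1" using \<beta> by linarith
  then have "caputo_differentiable \<beta> u t \<and> caputo_deriv \<beta> u t =
      t powr (\<nu> - \<beta>) * (\<Sum>n. a (Suc n) * (t powr \<nu>) ^ n / Gamma (\<nu> * real n + (\<nu> + 1 - \<beta>)))"
  proof cases
    case 1
    then show ?thesis
      using diff[OF t] deriv[OF t] by (simp add: caputo_differentiable_def caputo_deriv_def)
  next
    case 2
    define b where "b n = \<nu> * real n + \<nu>" for n
    define w where "w s = (t - s) powr - \<beta>" for s
    define g where "g n s = a (Suc n) / Gamma (b n) * (indicator {0<..<t} s * (s powr (b n - 1) * w s))"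
      for n s
    have b: "0 < b n" for n using \<nu> by (auto simp: b_def intro!: add_nonneg_pos)
    have G: "0 < Gamma (b n)" "0 < Gamma (b n + 1 - \<beta>)" for n
      using b[of n] 2 by (auto intro!: Gamma_real_pos)
    have w: "0 \<le> w s" for s by (simp add: w_def)
    have I: "has_bochner_integral lborel
        (\<lambda>s. c / Gamma (b n) * (indicator {0<..<t} s * (s powr (b n - 1) * w s)))
        (Gamma (1 - \<beta>) * t powr (\<nu> - \<beta>) * (c * (t powr \<nu>) ^ n / Gamma (\<nu> * real n + (\<nu> + 1 - \<beta>))))" for n c
    proof -
      have "0 < 1 - \<beta>" using 2 by simp
      from has_bochner_integral_mult_right[OF has_bochner_integral_Beta_scaled[OF b[of n] this t], of "c / Gamma (b n)"]
      have "has_bochner_integral lborel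
        (\<lambda>s. c / Gamma (b n) * (indicator {0<..<t} s * (s powr (b n - 1) * w s)))
        (c / Gamma (b n) * (Beta (b n) (1 - \<beta>) * t powr (b n - \<beta>)))"
        by (simp add: w_def)
      moreover have "c / Gamma (b n) * (Beta (b n) (1 - \<beta>) * t powr (b n - \<beta>))
        = Gamma (1 - \<beta>) * t powr (\<nu> - \<beta>) * (c * (t powr \<nu>) ^ n / Gamma (\<nu> * real n + (\<nu> + 1 - \<beta>)))"
      proof -
        have eq1: "t powr (b n - \<beta>) = (t powr \<nu>) ^ n * t powr (\<nu> - \<beta>)"
          using powr_power_shift[OF t, of \<nu> n "\<nu> - \<beta>"] by (simp add: b_def add_diff_eq)
        have eq2: "b n + (1 - \<beta>) = \<nu> * real n + (\<nu> + 1 - \<beta>)" by (simp add: b_def)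
        show ?thesis unfolding Beta_def eq1 eq2 using G(1)[of n] by simp
      qed
      ultimately show ?thesis by (simp only:)
    qed
    have norm_g: "norm (g n s) =
        \<bar>a (Suc n)\<bar> / Gamma (b n) * (indicator {0<..<t} s * (s powr (b n - 1) * w s))" for n s
      using G(1)[of n] w[of s] by (auto simp: g_def abs_mult indicator_def)
    have g_eq: "g n s = indicator {0<..<t} s * s powr (\<nu> - 1) * w s *
        (a (Suc n) * (s powr \<nu>) ^ n / Gamma (\<nu> * real n + \<nu>))" for n s
      using powr_power_shift[of s \<nu> n "\<nu> - 1"] by (auto simp: g_def indicator_def b_def add_diff_eq mult_ac)
    have int: "integrable lborel (g n)" for n
      using I[of "a (Suc n)" n] by (simp add: g_def[abs_def] has_bochner_integral_iff)
    have sn: "summable (\<lambda>n. norm (g n s))" for s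
      unfolding g_eq norm_mult[of "_ * w s"]
      by (intro summable_mult) (use summable_frac_series_Suc[OF \<nu>, of "s powr \<nu>"] in simp)
    have S: "summable (\<lambda>n. \<bar>a (Suc n) * (t powr \<nu>) ^ n / Gamma (\<nu> * real n + (\<nu> + 1 - \<beta>))\<bar>)"
      using 2 \<nu> by (intro summable_frac_series_Suc) auto
    have "(\<integral>s. norm (g n s) \<partial>lborel) =
       Gamma (1 - \<beta>) * t powr (\<nu> - \<beta>) * \<bar>a (Suc n) * (t powr \<nu>) ^ n / Gamma (\<nu> * real n + (\<nu> + 1 - \<beta>))\<bar>" for n
      unfolding norm_g using I[of "\<bar>a (Suc n)\<bar>" n] G(2)[of n]
      by (simp add: has_bochner_integral_iff abs_mult b_def algebra_simps)
    then have si: "summable (\<lambda>n. \<integral>s. norm (g n s) \<partial>lborel)"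
      using summable_mult[OF S] by simp
    have sum_g: "(\<Sum>n. g n s) = indicator {0<..<t} s * (deriv u s / (t - s) powr \<beta>)" for s
    proof (cases "0 < s \<and> s < t")
      case True
      have "(\<Sum>n. g n s) = indicator {0<..<t} s * s powr (\<nu> - 1) * w s *
          (\<Sum>n. a (Suc n) * (s powr \<nu>) ^ n / Gamma (\<nu> * real n + \<nu>))"
        unfolding g_eq by (rule suminf_mult) (rule summable_rabs_cancel[OF summable_frac_series_Suc[OF \<nu>]])
      then show ?thesis
        using True by (simp add: deriv w_def powr_minus divide_inverse mult_ac)
    qed (auto simp: g_def)
    have "(\<integral>s. g n s \<partial>lborel) =
       Gamma (1 - \<beta>) * t powr (\<nu> - \<beta>) * (a (Suc n) * (t powr \<nu>) ^ n / Gamma (\<nu> * real n + (\<nu> + 1 - \<beta>)))" for n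
      using I[of "a (Suc n)" n] by (simp add: g_def[abs_def] has_bochner_integral_iff)
    then have "(\<integral>s. (\<Sum>n. g n s) \<partial>lborel) = Gamma (1 - \<beta>) * t powr (\<nu> - \<beta>) *
        (\<Sum>n. a (Suc n) * (t powr \<nu>) ^ n / Gamma (\<nu> * real n + (\<nu> + 1 - \<beta>)))"
      using integral_suminf[OF int _ si] sn suminf_mult[OF summable_rabs_cancel[OF S]] by simp
    moreover have "integrable lborel (\<lambda>s. \<Sum>n. g n s)"
      using integrable_suminf[OF int _ si] sn by simp
    moreover have "Gamma (1 - \<beta>) \<noteq> 0" using 2 Gamma_real_pos[of "1 - \<beta>"] by linarith
    ultimately show ?thesis
      using 2 cont diff unfolding sum_g
      by (simp add: caputo_differentiable_def caputo_deriv_def set_integrable_def set_lebesgue_integral_def)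
  qed
  then show "caputo_differentiable \<beta> u t"
    and "caputo_deriv \<beta> u t =
      t powr (\<nu> - \<beta>) * (\<Sum>n. a (Suc n) * (t powr \<nu>) ^ n / Gamma (\<nu> * real n + (\<nu> + 1 - \<beta>)))"
    by auto
qed

end

section \<open>The fractional relaxation equation\<close>

text \<open>
  The Taylor coefficients of \<open>(1 + 2\<lambda> x) / (1 + 2\<lambda> x + \<gamma> x\<^sup>2)\<close>.
\<close>

fun relax_coeff :: "real \<Rightarrow> real \<Rightarrow> nat \<Rightarrow> real" where
  "relax_coeff lam \<gamma> 0 = 1"
| "relax_coeff lam \<gamma> (Suc 0) = 0"
| "relax_coeff lam \<gamma> (Suc (Suc n)) = - 2 * lam * relax_coeff lam \<gamma> (Suc n) - \<gamma> * relax_coeff lam \<gamma> n"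

lemma relax_coeff_bound:
  assumes "0 \<le> lam" "0 \<le> \<gamma>"
  shows "\<bar>relax_coeff lam \<gamma> n\<bar> \<le> (1 + 2 * lam + \<gamma>) ^ n"
  using assms
proof (induction lam \<gamma> n rule: relax_coeff.induct)
  case (3 lam \<gamma> n)
  let ?K = "1 + 2 * lam + \<gamma>"
  have K: "1 \<le> ?K" using 3 by simp
  have "\<bar>relax_coeff lam \<gamma> (Suc (Suc n))\<bar>
      \<le> 2 * lam * \<bar>relax_coeff lam \<gamma> (Suc n)\<bar> + \<gamma> * \<bar>relax_coeff lam \<gamma> n\<bar>"
    using 3(3,4) abs_triangle_ineq4[of "- 2 * lam * relax_coeff lam \<gamma> (Suc n)" "\<gamma> * relax_coeff lam \<gamma> n"]
    by (simp add: abs_mult)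
  also have "\<dots> \<le> 2 * lam * ?K ^ Suc n + \<gamma> * ?K ^ Suc n"
  proof (intro add_mono mult_left_mono)
    show "\<bar>relax_coeff lam \<gamma> (Suc n)\<bar> \<le> ?K ^ Suc n" using 3 by blast
    have "\<bar>relax_coeff lam \<gamma> n\<bar> \<le> ?K ^ n" using 3 by blast
    also have "\<dots> \<le> ?K ^ Suc n" using K by (intro power_increasing) auto
    finally show "\<bar>relax_coeff lam \<gamma> n\<bar> \<le> ?K ^ Suc n" .
  qed (use 3 in auto)
  also have "\<dots> = (?K - 1) * ?K ^ Suc n"
    by (simp add: algebra_simps)
  also have "\<dots> \<le> ?K * ?K ^ Suc n"
    using K by (intro mult_right_mono) auto
  finally show ?case by simp
qed auto

lemma relax_coeff_generating_function:
  assumes lam: "0 \<le> lam" and \<gamma>: "0 \<le> \<gamma>" and x: "(1 + 2 * lam + \<gamma>) * \<bar>x\<bar> < 1"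
  shows "(1 + 2 * lam * x + \<gamma> * x\<^sup>2) * (\<Sum>n. relax_coeff lam \<gamma> n * x ^ n) = 1 + 2 * lam * x"
proof -
  define c where "c = relax_coeff lam \<gamma>"
  have S: "summable (\<lambda>n. c n * x ^ n)"
  proof (rule summable_comparison_test)
    show "summable (\<lambda>n. ((1 + 2 * lam + \<gamma>) * \<bar>x\<bar>) ^ n)"
      using x lam \<gamma> by (intro summable_geometric) (auto simp: abs_mult)
    show "\<exists>N. \<forall>n\<ge>N. norm (c n * x ^ n) \<le> ((1 + 2 * lam + \<gamma>) * \<bar>x\<bar>) ^ n"
      using relax_coeff_bound[OF lam \<gamma>]
      by (auto simp: c_def abs_mult power_abs power_mult_distrib intro!: mult_right_mono)
  qed
  have S1: "summable (\<lambda>n. c (Suc n) * x ^ Suc n)"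
    using S by (subst summable_Suc_iff[of "\<lambda>n. c n * x ^ n"])
  have S2: "summable (\<lambda>n. c (Suc (Suc n)) * x ^ Suc (Suc n))"
    using S1 by (subst summable_Suc_iff[of "\<lambda>n. c (Suc n) * x ^ Suc n"])
  let ?A = "\<Sum>n. c n * x ^ n"
  have A1: "(\<Sum>n. c (Suc n) * x ^ Suc n) = ?A - 1"
    using suminf_split_head[OF S] by (simp add: c_def)
  have A2: "(\<Sum>n. c (Suc (Suc n)) * x ^ Suc (Suc n)) = ?A - 1"
    using suminf_split_head[OF S1] A1 by (simp add: c_def)
  have "c (Suc (Suc n)) * x ^ Suc (Suc n)
      = - 2 * lam * x * (c (Suc n) * x ^ Suc n) + - \<gamma> * x\<^sup>2 * (c n * x ^ n)" for n
    by (simp add: c_def algebra_simps power2_eq_square)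
  then have "(\<Sum>n. c (Suc (Suc n)) * x ^ Suc (Suc n))
      = - 2 * lam * x * (?A - 1) + - \<gamma> * x\<^sup>2 * ?A"
    using suminf_add[OF summable_mult[OF S1, of "- 2 * lam * x"] summable_mult[OF S, of "- \<gamma> * x\<^sup>2"]]
      suminf_mult[OF S1, of "- 2 * lam * x"] suminf_mult[OF S, of "- \<gamma> * x\<^sup>2"] A1
    by simp
  then show ?thesis unfolding A2 c_def[symmetric] by (simp add: algebra_simps)
qed

text \<open>
  The powers of both roots \<open>-\<lambda> \<plusminus> w\<close> of \<open>z\<^sup>2 + 2\<lambda> z + \<gamma>\<close> satisfy the recursion; the weights fit the
  initial values \<open>1\<close> and \<open>0\<close>.
\<close>

lemma relax_coeff_closed_form:
  fixes w :: complex
  assumes w: "w\<^sup>2 = of_real (lam\<^sup>2 - \<gamma>)" "w \<noteq> 0"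
  shows "of_real (relax_coeff lam \<gamma> n) =
    1 / 2 * ((1 + of_real lam / w) * (- of_real lam + w) ^ n + (1 - of_real lam / w) * (- of_real lam - w) ^ n)"
  using w
proof (induction lam \<gamma> n rule: relax_coeff.induct)
  case (3 lam \<gamma> n)
  \<comment> \<open>The sign \<open>s\<close> treats both roots of \<open>z\<^sup>2 + 2\<lambda> z + \<gamma>\<close> at once.\<close>
  have *: "(- of_real lam + s * w) ^ Suc (Suc n)
      = - 2 * of_real lam * (- of_real lam + s * w) ^ Suc n - of_real \<gamma> * (- of_real lam + s * w) ^ n"
    if "s\<^sup>2 = 1" for s
  proof -
    have sw: "(s * w)\<^sup>2 = of_real (lam\<^sup>2 - \<gamma>)"
      using 3(3) that by (simp add: power_mult_distrib)
    have "(- of_real lam + s * w)\<^sup>2 = - 2 * of_real lam * (- of_real lam + s * w) - of_real \<gamma>"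
      using sw by (simp add: power2_eq_square algebra_simps)
    moreover have "x ^ Suc (Suc n) = p * x ^ Suc n - q * x ^ n" if "x\<^sup>2 = p * x - q" for x p q :: complex
    proof -
      have "x ^ Suc (Suc n) = x\<^sup>2 * x ^ n" by (simp add: power2_eq_square)
      then show ?thesis unfolding that by (simp add: algebra_simps)
    qed
    ultimately show ?thesis by blast
  qed
  define A B where "A = - of_real lam + w" and "B = - of_real lam - w"
  have A: "A ^ Suc (Suc n) = - 2 * of_real lam * A ^ Suc n - of_real \<gamma> * A ^ n"
    and B: "B ^ Suc (Suc n) = - 2 * of_real lam * B ^ Suc n - of_real \<gamma> * B ^ n"
    using *[of 1] *[of "-1"] by (simp_all only: A_def B_def) auto
  have "of_real (relax_coeff lam \<gamma> (Suc (Suc n))) =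
      - 2 * of_real lam * complex_of_real (relax_coeff lam \<gamma> (Suc n)) - of_real \<gamma> * of_real (relax_coeff lam \<gamma> n)"
    by simp
  also have "\<dots> = 1 / 2 * ((1 + of_real lam / w) * A ^ Suc (Suc n) + (1 - of_real lam / w) * B ^ Suc (Suc n))"
    unfolding A B 3(1)[OF 3(3,4)] 3(2)[OF 3(3,4)] A_def[symmetric] B_def[symmetric]
    by (simp add: algebra_simps del: power_Suc)
  finally show ?case unfolding A_def B_def .
qed (auto simp: field_simps)

lemma frac_series_relax_Mittag_Leffler:
  fixes w :: complex
  assumes \<nu>: "0 < \<nu>" and lam: "0 \<le> lam" and \<gamma>: "0 \<le> \<gamma>"
    and w: "w\<^sup>2 = of_real (lam\<^sup>2 - \<gamma>)" "w \<noteq> 0"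
  shows "of_real (frac_series \<nu> (relax_coeff lam \<gamma>) t) =
          1 / 2 * ((1 + of_real lam / w) * mittag_leffler \<nu> 1 ((- of_real lam + w) * of_real (t powr \<nu>))
                 + (1 - of_real lam / w) * mittag_leffler \<nu> 1 ((- of_real lam - w) * of_real (t powr \<nu>)))"
proof -
  have ml: "(\<lambda>n. z ^ n / of_real (Gamma (\<nu> * real n + 1))) sums mittag_leffler \<nu> 1 z" for z
    unfolding mittag_leffler_def
    using summable_norm_cancel[OF summable_series_over_Gamma[OF \<nu>, of 1 "\<lambda>_. 1" 1 z]]
    by (intro summable_sums) simp
  let ?T = "complex_of_real (t powr \<nu>)"
  have "(\<lambda>n. of_real (relax_coeff lam \<gamma> n * (t powr \<nu>) ^ n / Gamma (\<nu> * real n + 1)) :: complex)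
      sums of_real (frac_series \<nu> (relax_coeff lam \<gamma>) t)"
    unfolding frac_series_def sums_of_real_iff
    by (intro summable_sums summable_rabs_cancel[OF summable_frac_series[OF \<nu> relax_coeff_bound[OF lam \<gamma>]]]) simp
  moreover have "(\<lambda>n. of_real (relax_coeff lam \<gamma> n * (t powr \<nu>) ^ n / Gamma (\<nu> * real n + 1)) :: complex)
    = (\<lambda>n. 1 / 2 * ((1 + of_real lam / w) * (((- of_real lam + w) * ?T) ^ n / of_real (Gamma (\<nu> * real n + 1)))
         + (1 - of_real lam / w) * (((- of_real lam - w) * ?T) ^ n / of_real (Gamma (\<nu> * real n + 1)))))"
  proof
    fix n
    have distr: "1 / 2 * (p * A ^ n + q * B ^ n) * T ^ n / G
        = 1 / 2 * (p * ((A * T) ^ n / G) + q * ((B * T) ^ n / G))" for p q A B T G :: complex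
      by (cases "G = 0") (simp_all add: power_mult_distrib field_simps)
    show "of_real (relax_coeff lam \<gamma> n * (t powr \<nu>) ^ n / Gamma (\<nu> * real n + 1))
      = 1 / 2 * ((1 + of_real lam / w) * (((- of_real lam + w) * ?T) ^ n / of_real (Gamma (\<nu> * real n + 1)))
         + (1 - of_real lam / w) * (((- of_real lam - w) * ?T) ^ n / of_real (Gamma (\<nu> * real n + 1))))"
      unfolding of_real_divide of_real_mult of_real_power relax_coeff_closed_form[OF w] by (rule distr)
  qed
  ultimately have "(\<lambda>n. 1 / 2 * ((1 + of_real lam / w) * (((- of_real lam + w) * ?T) ^ n / of_real (Gamma (\<nu> * real n + 1)))
         + (1 - of_real lam / w) * (((- of_real lam - w) * ?T) ^ n / of_real (Gamma (\<nu> * real n + 1)))))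
     sums of_real (frac_series \<nu> (relax_coeff lam \<gamma>) t)" by (simp only:)
  moreover note sums_mult[OF sums_add[OF sums_mult[OF ml] sums_mult[OF ml]], of "1 / 2"
      "1 + of_real lam / w" "(- of_real lam + w) * ?T" "1 - of_real lam / w" "(- of_real lam - w) * ?T"]
  ultimately show ?thesis by (rule sums_unique2)
qed

text \<open>
  The derivative of order \<open>\<nu>\<close> shifts the coefficients by one place. The one of order \<open>2\<nu>\<close> starts
  with a multiple of \<open>a\<^sub>1 t\<^bsup>-\<nu>\<^esup>\<close>, which vanishes since \<open>a\<^sub>1 = 0\<close>, and from there on shifts by two
  places, so that the recursion of the coefficients becomes the equation.
\<close>

lemma frac_series_relax_equation:
  assumes \<nu>: "0 < \<nu>" "\<nu> \<le> 1 / 2" and lam: "0 \<le> lam" and \<gamma>: "0 \<le> \<gamma>" and t: "0 < t"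
    and u: "\<And>s. 0 \<le> s \<Longrightarrow> u s = frac_series \<nu> (relax_coeff lam \<gamma>) s"
  shows "caputo_deriv (2 * \<nu>) u t + 2 * lam * caputo_deriv \<nu> u t = - \<gamma> * u t"
proof -
  define c where "c = relax_coeff lam \<gamma>"
  define T where "T = t powr \<nu>"
  note bound = relax_coeff_bound[OF lam \<gamma>]
  let ?s = "\<lambda>k n. c (n + k) * T ^ n / Gamma (\<nu> * real n + 1)"
  have s0: "summable (?s 0)"
    using summable_rabs_cancel[OF summable_frac_series[OF \<nu>(1) bound], of 1] by (simp add: c_def)
  have s1: "summable (?s 1)"
    using summable_rabs_cancel[OF summable_frac_series_Suc[OF \<nu>(1) bound], of 1] by (simp add: c_def)
  have D1: "caputo_deriv \<nu> u t = (\<Sum>n. ?s 1 n)"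
    using frac_series_Caputo(2)[OF \<nu>(1) bound u, of \<nu> t] \<nu> t by (simp add: c_def T_def)
  have "caputo_deriv (2 * \<nu>) u t = t powr (- \<nu>) * (\<Sum>n. c (Suc n) * T ^ n / Gamma (\<nu> * real n + (1 - \<nu>)))"
    using frac_series_Caputo(2)[OF \<nu>(1) bound u, of "2 * \<nu>" t] \<nu> t by (simp add: c_def T_def algebra_simps)
  also have "(\<Sum>n. c (Suc n) * T ^ n / Gamma (\<nu> * real n + (1 - \<nu>)))
      = (\<Sum>n. c (Suc (Suc n)) * T ^ Suc n / Gamma (\<nu> * real (Suc n) + (1 - \<nu>)))"
    using suminf_split_head[OF summable_rabs_cancel[OF summable_frac_series_Suc[OF \<nu>(1) bound, of "1 - \<nu>" T]]] \<nu>
    by (simp add: c_def)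
  also have "\<dots> = (\<Sum>n. T * ?s 2 n)"
    by (simp add: algebra_simps)
  also have "\<dots> = (\<Sum>n. T * (- 2 * lam * ?s 1 n + - \<gamma> * ?s 0 n))"
  proof (intro arg_cong[where f = suminf] ext)
    fix n
    have "A * p / G = - 2 * lam * (B * p / G) + - \<gamma> * (C * p / G)"
      if "A = - 2 * lam * B - \<gamma> * C" for A B C p G :: real
      using that by (simp add: left_diff_distrib diff_divide_distrib mult.assoc)
    moreover have "c (n + 2) = - 2 * lam * c (n + 1) - \<gamma> * c (n + 0)"
      by (simp add: c_def)
    ultimately show "T * ?s 2 n = T * (- 2 * lam * ?s 1 n + - \<gamma> * ?s 0 n)" by metis
  qed
  also have "\<dots> = T * (- 2 * lam * (\<Sum>n. ?s 1 n) + - \<gamma> * (\<Sum>n. ?s 0 n))"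
  proof -
    note a = suminf_add[OF summable_mult[OF s1, of "- 2 * lam"] summable_mult[OF s0, of "- \<gamma>"]]
    have "summable (\<lambda>n. - 2 * lam * ?s 1 n + - \<gamma> * ?s 0 n)"
      by (intro summable_add summable_mult s0 s1)
    from suminf_mult[OF this, of T] show ?thesis
      unfolding a[symmetric] suminf_mult[OF s1] suminf_mult[OF s0] .
  qed
  also have "t powr - \<nu> * \<dots> = - 2 * lam * (\<Sum>n. ?s 1 n) + - \<gamma> * (\<Sum>n. ?s 0 n)"
    using t by (simp add: T_def powr_minus)
  also have "(\<Sum>n. ?s 0 n) = u t"
    using u[of t] t by (simp add: frac_series_def c_def T_def)
  finally show ?thesis unfolding D1 by simp
qed

section \<open>Uniqueness of Laplace transforms\<close>

text \<open>
  Lerch's theorem in the form needed for a function of unknown regularity. In the variable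
  \<open>x = exp (-t)\<close> the hypothesis says that \<open>exp (-\<alpha> t) D(t)\<close> is orthogonal to all monomials \<open>x\<^sup>n\<close>, hence,
  by Weierstrass approximation on \<open>[0, 1]\<close>, to all continuous functions of \<open>x\<close>. A continuous bump
  on the interval then excludes that \<open>D\<close> is positive on the open interval.
\<close>

lemma Laplace_zero_imp_not_positive:
  fixes D :: "real \<Rightarrow> real"
  assumes int: "\<And>n::nat. integrable lborel (\<lambda>t. indicator {0<..} t * (exp (- (\<alpha> + real n) * t) * D t))"
    and zero: "\<And>n::nat. (\<integral>t. indicator {0<..} t * (exp (- (\<alpha> + real n) * t) * D t) \<partial>lborel) = 0"
    and cd: "0 \<le> c" "c < d"
  shows "\<exists>t\<in>{c<..<d}. D t \<le> 0"
proof (rule ccontr)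
  assume "\<not> ?thesis"
  then have pos: "0 < D t" if "t \<in> {c<..<d}" for t using that by force
  define E where "E t = indicator {0<..} t * (exp (- \<alpha> * t) * D t)" for t
  \<comment> \<open>The bump: positive exactly when \<open>x = exp (-t)\<close> with \<open>c < t < d\<close>.\<close>
  define h where "h x = max 0 ((x - exp (- d)) * (exp (- c) - x))" for x :: real
  have E_int: "integrable lborel E"
    using int[of 0] by (simp add: E_def[abs_def])
  have mono_int: "has_bochner_integral lborel (\<lambda>t. exp (- t) ^ n * E t) 0" for n
  proof -
    have "indicator {0<..} t * (exp (- (\<alpha> + real n) * t) * D t) = exp (- t) ^ n * E t" for t
      by (simp add: E_def exp_of_nat_mult[symmetric] exp_add[symmetric] algebra_simps)
    then show ?thesis using int[of n] zero[of n] by (simp add: has_bochner_integral_iff)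
  qed
  have poly_int: "has_bochner_integral lborel (\<lambda>t. g (exp (- t)) * E t) 0"
    if g: "real_polynomial_function g" for g
  proof -
    obtain a n where "g = (\<lambda>x. \<Sum>i\<le>n. a i * x ^ i)"
      using g by (auto simp: real_polynomial_function_iff_sum)
    moreover have "has_bochner_integral lborel (\<lambda>t. \<Sum>i\<le>n. a i * (exp (- t) ^ i * E t)) (\<Sum>i\<le>n. a i * 0)"
      by (intro has_bochner_integral_sum has_bochner_integral_mult_right mono_int)
    ultimately show ?thesis by (simp add: sum_distrib_right mult.assoc)
  qed
  have h_cont: "continuous_on {0..1} h"
    unfolding h_def by (intro continuous_intros)
  have [measurable]: "h \<in> borel_measurable borel"
    unfolding h_def by measurable
  have [measurable]: "E \<in> borel_measurable lborel" using E_int by auto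
  have range: "exp (- t) \<in> {0..1}" if "E t \<noteq> 0" for t
    using that by (auto simp: E_def indicator_def split: if_splits)
  obtain B where B: "\<And>x. x \<in> {0..1} \<Longrightarrow> \<bar>h x\<bar> \<le> B"
    using compact_imp_bounded[OF compact_continuous_image[OF h_cont compact_Icc]]
    unfolding bounded_iff by (metis imageI real_norm_def)
  have hE_int: "integrable lborel (\<lambda>t. h (exp (- t)) * E t)"
  proof (rule Bochner_Integration.integrable_bound)
    show "integrable lborel (\<lambda>t. B * norm (E t))" using E_int by simp
    have "norm (h (exp (- t)) * E t) \<le> norm (B * norm (E t))" for t
    proof (cases "E t = 0")
      case False
      from B[OF range[OF False]] show ?thesis by (auto simp: abs_mult intro!: mult_right_mono)
    qed simp
    then show "AE t in lborel. norm (h (exp (- t)) * E t) \<le> norm (B * norm (E t))" by simp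
  qed measurable
  have small: "\<bar>\<integral>t. h (exp (- t)) * E t \<partial>lborel\<bar> \<le> e * (\<integral>t. \<bar>E t\<bar> \<partial>lborel)" if e: "0 < e" for e
  proof -
    obtain g where g: "real_polynomial_function g" "\<And>x. x \<in> {0..1} \<Longrightarrow> \<bar>h x - g x\<bar> < e"
      using Stone_Weierstrass_real_polynomial_function[OF compact_Icc h_cont e] by blast
    have "(\<integral>t. h (exp (- t)) * E t \<partial>lborel) = (\<integral>t. h (exp (- t)) * E t - g (exp (- t)) * E t \<partial>lborel)"
      using hE_int poly_int[OF g(1)] by (simp add: has_bochner_integral_iff)
    also have "\<bar>\<dots>\<bar> \<le> (\<integral>t. e * \<bar>E t\<bar> \<partial>lborel)"
    proof (rule integral_abs_bound_integral)
      show "integrable lborel (\<lambda>t. h (exp (- t)) * E t - g (exp (- t)) * E t)"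
        using hE_int poly_int[OF g(1)] by (auto simp: has_bochner_integral_iff)
      show "integrable lborel (\<lambda>t. e * \<bar>E t\<bar>)" using E_int by simp
      fix t
      show "\<bar>h (exp (- t)) * E t - g (exp (- t)) * E t\<bar> \<le> e * \<bar>E t\<bar>"
      proof (cases "E t = 0")
        case False
        from g(2)[OF range[OF False]] show ?thesis
          by (auto simp: abs_mult left_diff_distrib[symmetric] intro!: mult_right_mono)
      qed simp
    qed
    finally show ?thesis by simp
  qed
  have "(\<integral>t. h (exp (- t)) * E t \<partial>lborel) = 0"
  proof (rule ccontr)
    define I J where "I = (\<integral>t. h (exp (- t)) * E t \<partial>lborel)" and "J = (\<integral>t. \<bar>E t\<bar> \<partial>lborel)"
    assume "\<not> ?thesis"
    then have I: "0 < \<bar>I\<bar>" by (simp add: I_def)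
    have J: "0 \<le> J" by (simp add: J_def)
    then have "0 < \<bar>I\<bar> / (2 * (J + 1))" using I by simp
    from small[OF this] have "\<bar>I\<bar> \<le> \<bar>I\<bar> / (2 * (J + 1)) * J"
      by (simp only: I_def[symmetric] J_def[symmetric])
    then have "\<bar>I\<bar> * (2 * (J + 1)) \<le> \<bar>I\<bar> * J" using J by (simp add: field_simps)
    then have "2 * (J + 1) \<le> J" using I by simp
    then show False using J by simp
  qed
  moreover have support: "h (exp (- t)) * E t > 0" if "t \<in> {c<..<d}" for t
    using that pos[OF that] cd by (auto simp: h_def E_def max_def intro!: mult_pos_pos)
  moreover have "0 \<le> h (exp (- t)) * E t" for t
  proof (cases "t \<in> {c<..<d}")
    case False
    then have "h (exp (- t)) = 0"
    proof (cases "t \<le> c")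
      case True
      then have "(exp (- t) - exp (- d)) * (exp (- c) - exp (- t)) \<le> 0"
        using cd by (intro mult_nonneg_nonpos) auto
      then show ?thesis by (simp add: h_def)
    next
      case False
      with \<open>t \<notin> {c<..<d}\<close> have "d \<le> t" by auto
      then have "(exp (- t) - exp (- d)) * (exp (- c) - exp (- t)) \<le> 0"
        using cd by (intro mult_nonpos_nonneg) auto
      then show ?thesis by (simp add: h_def)
    qed
    then show ?thesis by simp
  qed (use support in fastforce)
  ultimately have "AE t in lborel. h (exp (- t)) * E t = 0"
    using integral_nonneg_eq_0_iff_AE[OF hE_int] by simp
  then have "AE t in lborel. t \<notin> {c<..<d}"
    by eventually_elim (use support in fastforce)
  then have "emeasure lborel {c<..<d} = 0"
    by (subst (asm) AE_iff_measurable[of "{c<..<d}"]) auto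
  then show False using cd by (simp)
qed

text \<open>
  Equality of the transforms gives points arbitrarily close to \<open>t\<close> on a chosen side of \<open>t\<close> at which
  \<open>l \<le> f\<close>, and likewise for \<open>f \<le> l\<close>. As \<open>l\<close> decreases, points on the right transport \<open>f \<le> l\<close> to \<open>t\<close>,
  points on the left transport \<open>l \<le> f\<close>. Monotonicity of \<open>\<ell>(\<gamma>, t)\<close> in \<open>t\<close> is immediate, whereas its continuity
  would require that the paths of \<open>H\<close> increase strictly.
\<close>

lemma Laplace_unique_antimono_continuous:
  fixes l f :: "real \<Rightarrow> real"
  assumes l: "\<And>s t. 0 < s \<Longrightarrow> s \<le> t \<Longrightarrow> l t \<le> l s" and f: "\<And>t. 0 < t \<Longrightarrow> isCont f t"
    and Laplace_l: "\<And>\<mu>. \<alpha> \<le> \<mu> \<Longrightarrow> has_bochner_integral lborel (\<lambda>t. indicator {0<..} t * (exp (- \<mu> * t) * l t)) (I \<mu>)"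
    and Laplace_f: "\<And>\<mu>. \<alpha> \<le> \<mu> \<Longrightarrow> has_bochner_integral lborel (\<lambda>t. indicator {0<..} t * (exp (- \<mu> * t) * f t)) (I \<mu>)"
    and t: "0 < t"
  shows "l t = f t"
proof -
  have lap: "has_bochner_integral lborel (\<lambda>t. indicator {0<..} t * (exp (- (\<alpha> + real n) * t) * (l t - f t))) 0"
    "has_bochner_integral lborel (\<lambda>t. indicator {0<..} t * (exp (- (\<alpha> + real n) * t) * (f t - l t))) 0" for n
    using has_bochner_integral_diff[OF Laplace_l[of "\<alpha> + real n"] Laplace_f[of "\<alpha> + real n"]]
      has_bochner_integral_diff[OF Laplace_f[of "\<alpha> + real n"] Laplace_l[of "\<alpha> + real n"]]
    by (simp_all add: right_diff_distrib)
  have le: "\<exists>s\<in>{c<..<d}. l s \<le> f s" if "0 \<le> c" "c < d" for c d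
    using Laplace_zero_imp_not_positive[of \<alpha> "\<lambda>t. l t - f t" c d] lap(1) that
    by (simp add: has_bochner_integral_iff)
  have ge: "\<exists>s\<in>{c<..<d}. f s \<le> l s" if "0 \<le> c" "c < d" for c d
    using Laplace_zero_imp_not_positive[of \<alpha> "\<lambda>t. f t - l t" c d] lap(2) that
    by (simp add: has_bochner_integral_iff)
  have near: "\<bar>f s - f t\<bar> < e" if "\<bar>s - t\<bar> < d" "\<forall>x. dist x t < d \<longrightarrow> dist (f x) (f t) < e" for s d e
    using that by (simp add: dist_real_def)
  have "f t \<le> l t"
  proof (rule field_le_epsilon)
    fix e :: real assume e: "0 < e"
    from f[OF t] e obtain d where d: "0 < d" "\<forall>x. dist x t < d \<longrightarrow> dist (f x) (f t) < e"
      unfolding continuous_at_eps_delta by blast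
    obtain s where "s \<in> {t<..<t + d}" "f s \<le> l s" using ge[of t "t + d"] t d by auto
    with l[OF t, of s] near[OF _ d(2), of s] show "f t \<le> l t + e" by auto
  qed
  moreover have "l t \<le> f t"
  proof (rule field_le_epsilon)
    fix e :: real assume e: "0 < e"
    from f[OF t] e obtain d where d: "0 < d" "\<forall>x. dist x t < d \<longrightarrow> dist (f x) (f t) < e"
      unfolding continuous_at_eps_delta by blast
    obtain s where s: "s \<in> {max 0 (t - d)<..<t}" "l s \<le> f s" using le[of "max 0 (t - d)" t] t d by auto
    with l[of s t] near[OF _ d(2), of s] show "l t \<le> f t + e" by auto
  qed
  ultimately show ?thesis by simp
qed

section \<open>A Poisson process at an independent random time\<close>

lemma (in prob_space) poisson_process_pgf:
  assumes N: "poisson_process M \<Lambda> N" and \<Lambda>: "0 < \<Lambda>" and t: "0 < t"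
  shows "expectation (\<lambda>\<omega>. u ^ N t \<omega>) = exp (- (\<Lambda> * (1 - u)) * t)"
proof -
  have [measurable]: "N t \<in> measurable M (count_space UNIV)" and N0: "\<And>\<omega>. \<omega> \<in> space M \<Longrightarrow> N 0 \<omega> = 0"
    using N t by (auto simp: poisson_process_def)
  define r where "r = \<Lambda> * t"
  have r: "0 < r" using \<Lambda> t by (simp add: r_def)
  have "distr M (count_space UNIV) (\<lambda>\<omega>. N t \<omega> - N 0 \<omega>) = measure_pmf (poisson_pmf (\<Lambda> * (t - 0)))"
    using N t unfolding poisson_process_def by blast
  moreover have "distr M (count_space UNIV) (\<lambda>\<omega>. N t \<omega> - N 0 \<omega>) = distr M (count_space UNIV) (N t)"
    by (intro distr_cong) (auto simp: N0)
  ultimately have dist: "distr M (count_space UNIV) (N t) = measure_pmf (poisson_pmf r)"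
    by (simp add: r_def)
  have "(\<lambda>k. exp (- r) * ((r * u) ^ k /\<^sub>R fact k)) sums (exp (- r) * exp (r * u))"
    by (intro sums_mult exp_converges)
  then have s: "(\<lambda>k. pmf (poisson_pmf r) k * u ^ k) sums (exp (- r) * exp (r * u))"
    using r by (simp add: power_mult_distrib field_simps)
  have "summable (\<lambda>k. exp (- r) * ((r * \<bar>u\<bar>) ^ k /\<^sub>R fact k))"
    by (intro summable_mult summable_exp_generic)
  then have abs: "summable (\<lambda>k. norm (pmf (poisson_pmf r) k * u ^ k))"
    using r by (simp add: abs_mult power_abs power_mult_distrib field_simps)
  have "expectation (\<lambda>\<omega>. u ^ N t \<omega>) = (\<integral>k. u ^ k \<partial>distr M (count_space UNIV) (N t))"
    by (simp add: integral_distr)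
  also have "\<dots> = (\<integral>k. pmf (poisson_pmf r) k *\<^sub>R u ^ k \<partial>count_space UNIV)"
    unfolding dist measure_pmf_eq_density by (rule integral_density) auto
  also have "\<dots> = exp (- r) * exp (r * u)"
    using abs s by (simp add: integral_count_space_nat integrable_count_space_nat_iff sums_unique[symmetric])
  finally show ?thesis by (simp add: exp_add[symmetric] r_def algebra_simps)
qed

lemma (in prob_space) nat_valued_pgf:
  fixes Z :: "'a \<Rightarrow> nat" and u :: real
  assumes Z[measurable]: "Z \<in> measurable M (count_space UNIV)" and u: "\<bar>u\<bar> \<le> 1"
  shows "(\<Sum>k. u ^ k * prob {\<omega> \<in> space M. Z \<omega> = k}) = expectation (\<lambda>\<omega>. u ^ Z \<omega>)"
proof -
  define g where "g k \<omega> = u ^ k * indicator {\<omega> \<in> space M. Z \<omega> = k} \<omega>" for k \<omega>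
  have fin: "g k \<omega> = 0" if "k \<noteq> Z \<omega>" for k \<omega>
    using that by (simp add: g_def)
  have int: "integrable M (g k)" for k
    unfolding g_def[abs_def] by (intro integrable_mult_right integrable_real_indicator) (auto simp: emeasure_eq_measure)
  have sn: "summable (\<lambda>k. norm (g k \<omega>))" for \<omega>
    by (rule summable_finite[of "{Z \<omega>}"]) (auto simp: fin)
  have "(\<lambda>k. prob {\<omega> \<in> space M. Z \<omega> = k}) sums prob (\<Union>k. {\<omega> \<in> space M. Z \<omega> = k})"
    by (intro finite_measure_UNION) (auto simp: disjoint_family_on_def)
  then have sp: "summable (\<lambda>k. prob {\<omega> \<in> space M. Z \<omega> = k})" by (rule sums_summable)
  have "(\<integral>\<omega>. norm (g k \<omega>) \<partial>M) = \<bar>u\<bar> ^ k * prob {\<omega> \<in> space M. Z \<omega> = k}" for k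
  proof -
    have "norm (g k \<omega>) = \<bar>u\<bar> ^ k * indicator {\<omega> \<in> space M. Z \<omega> = k} \<omega>" for \<omega>
      by (simp add: g_def abs_mult power_abs)
    then show ?thesis by simp
  qed
  then have si: "summable (\<lambda>k. \<integral>\<omega>. norm (g k \<omega>) \<partial>M)"
    using u by (intro summable_comparison_test[OF _ sp])
      (auto intro!: exI[of _ 0] mult_left_le_one_le power_le_one simp: abs_mult)
  have "(\<Sum>k. \<integral>\<omega>. g k \<omega> \<partial>M) = (\<integral>\<omega>. (\<Sum>k. g k \<omega>) \<partial>M)"
    using integral_suminf[OF int _ si] sn by simp
  also have "\<dots> = expectation (\<lambda>\<omega>. u ^ Z \<omega>)"
  proof (rule Bochner_Integration.integral_cong[OF refl])
    fix \<omega> assume "\<omega> \<in> space M"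
    then show "(\<Sum>k. g k \<omega>) = u ^ Z \<omega>"
      by (subst suminf_finite[of "{Z \<omega>}"]) (auto simp: fin g_def)
  qed
  finally show ?thesis by (simp add: g_def)
qed

text \<open>
  The approximation stays strictly above \<open>l\<close>, so that right-continuity of the Poisson paths applies
  even at a jump, and it is positive, so that the Poisson law of the increments from time \<open>0\<close> applies.
\<close>

lemma dyadic_from_above:
  fixes l :: real
  assumes l: "0 \<le> l"
  shows "filterlim (\<lambda>m. (real (nat \<lfloor>2 ^ m * l\<rfloor>) + 1) / 2 ^ m) (at_right l) sequentially"
proof -
  let ?d = "\<lambda>m. (real (nat \<lfloor>2 ^ m * l\<rfloor>) + 1) / 2 ^ m"
  have nat: "real (nat \<lfloor>2 ^ m * l\<rfloor>) = of_int \<lfloor>2 ^ m * l\<rfloor>" for m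
    using l by (simp add: of_nat_nat)
  have gt: "l < ?d m" for m
    unfolding nat pos_less_divide_eq[OF zero_less_power[OF zero_less_numeral]]
    using floor_correct[of "2 ^ m * l"] by (simp add: mult.commute)
  have le: "?d m \<le> l + (1 / 2) ^ m" for m
  proof -
    have "?d m \<le> (2 ^ m * l + 1) / 2 ^ m"
      unfolding nat by (intro divide_right_mono) auto
    also have "\<dots> = l + (1 / 2) ^ m" by (simp add: add_divide_distrib power_one_over)
    finally show ?thesis .
  qed
  have "(\<lambda>m. l + (1 / 2) ^ m) \<longlonglongrightarrow> l + 0"
    by (intro tendsto_add tendsto_const LIMSEQ_power_zero) simp
  then have "?d \<longlonglongrightarrow> l"
    using gt le by (intro tendsto_sandwich[of "\<lambda>_. l" ?d sequentially "\<lambda>m. l + (1 / 2) ^ m"])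
      (auto intro!: always_eventually less_imp_le)
  then show ?thesis
    using gt by (auto simp: filterlim_at intro!: always_eventually) (metis less_irrefl)
qed

text \<open>
  Evaluating a path at a random time is not measurable on the product space of all paths. Therefore
  the random time is first replaced by a dyadic value slightly above it: then only countably many
  coordinates of the path matter, and Fubini's theorem for the product of the two laws computes the
  expectation. Right-continuity of the paths and dominated convergence remove the approximation.
\<close>

lemma (in prob_space) poisson_process_at_random_time:
  fixes N :: "real \<Rightarrow> 'a \<Rightarrow> nat" and L :: "real \<Rightarrow> 'a \<Rightarrow> real"
  assumes N: "poisson_process M \<Lambda> N" and \<Lambda>: "0 < \<Lambda>"
    and indep: "independent_processes M (\<lambda>t \<omega>. real (N t \<omega>)) L"
    and t: "0 \<le> t" and L_nonneg: "\<And>\<omega>. 0 \<le> L t \<omega>"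
  shows "(\<lambda>\<omega>. N (L t \<omega>) \<omega>) \<in> measurable M (count_space UNIV)"
    and "\<bar>u\<bar> \<le> 1 \<Longrightarrow> expectation (\<lambda>\<omega>. u ^ N (L t \<omega>) \<omega>) = expectation (\<lambda>\<omega>. exp (- (\<Lambda> * (1 - u)) * L t \<omega>))"
proof -
  let ?P = "Pi\<^sub>M {0..} (\<lambda>_. borel) :: (real \<Rightarrow> real) measure"
  define X where "X \<omega> = (\<lambda>s\<in>{0..}. real (N s \<omega>))" for \<omega>
  define Y where "Y \<omega> = (\<lambda>s\<in>{0..}. L s \<omega>)" for \<omega>
  have XY: "indep_var ?P X ?P Y"
    using indep by (simp add: independent_processes_def X_def[abs_def] Y_def[abs_def])
  then have X[measurable]: "X \<in> measurable M ?P" and Y[measurable]: "Y \<in> measurable M ?P"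
    by (auto dest: indep_var_rv1 indep_var_rv2)
  have Y_t: "Y \<omega> t = L t \<omega>" for \<omega> using t by (simp add: Y_def)
  have proj: "(\<lambda>f. f s) \<in> borel_measurable ?P" if "0 \<le> s" for s
    using that by (intro measurable_component_singleton) auto
  from measurable_compose[OF Y proj[OF t]]
  have L[measurable]: "L t \<in> borel_measurable M" by (simp add: Y_t)
  have N_meas[measurable]: "\<And>s. 0 \<le> s \<Longrightarrow> N s \<in> measurable M (count_space UNIV)"
    using N by (simp add: poisson_process_def)
  define d where "d m l = (real (nat \<lfloor>2 ^ m * l\<rfloor>) + 1) / 2 ^ m" for m :: nat and l :: real
  have d_pos: "0 < d m l" for m l by (simp add: d_def)
  have conv: "\<forall>\<^sub>F m in sequentially. N (d m (L t \<omega>)) \<omega> = N (L t \<omega>) \<omega>" if "\<omega> \<in> space M" for \<omega>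
  proof -
    have "continuous (at_right (L t \<omega>)) (\<lambda>s. N s \<omega>)"
      using N that L_nonneg by (auto simp: poisson_process_def)
    then have "((\<lambda>s. N s \<omega>) \<longlongrightarrow> N (L t \<omega>) \<omega>) (at_right (L t \<omega>))"
      by (simp add: continuous_within)
    from filterlim_compose[OF this dyadic_from_above[OF L_nonneg]] show ?thesis
      by (simp add: tendsto_discrete d_def)
  qed
  have Nd[measurable]: "(\<lambda>\<omega>. N (d m (L t \<omega>)) \<omega>) \<in> measurable M (count_space UNIV)" for m
    unfolding d_def
    by (rule measurable_compose_countable[where f = "\<lambda>j \<omega>. N ((real j + 1) / 2 ^ m) \<omega>"
          and g = "\<lambda>\<omega>. nat \<lfloor>2 ^ m * L t \<omega>\<rfloor>"]) measurable
  have "(\<lambda>\<omega>. real (N (L t \<omega>) \<omega>)) \<in> borel_measurable M"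
  proof (rule borel_measurable_LIMSEQ_real)
    show "(\<lambda>m. real (N (d m (L t \<omega>)) \<omega>)) \<longlonglongrightarrow> real (N (L t \<omega>) \<omega>)" if "\<omega> \<in> space M" for \<omega>
      using conv[OF that] by (intro tendsto_eventually) (auto elim: eventually_mono)
  qed measurable
  then have "(\<lambda>\<omega>. nat \<lfloor>real (N (L t \<omega>) \<omega>)\<rfloor>) \<in> measurable M (count_space UNIV)"
    by measurable
  then show NL[measurable]: "(\<lambda>\<omega>. N (L t \<omega>) \<omega>) \<in> measurable M (count_space UNIV)" by simp
  assume u: "\<bar>u\<bar> \<le> 1"
  define \<gamma> where "\<gamma> = \<Lambda> * (1 - u)"
  have \<gamma>: "0 \<le> \<gamma>" using \<Lambda> u by (simp add: \<gamma>_def)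
  have u_le: "\<bar>u ^ k\<bar> \<le> 1" for k using u by (simp add: power_abs power_le_one)
  have eq: "expectation (\<lambda>\<omega>. u ^ N (d m (L t \<omega>)) \<omega>) = expectation (\<lambda>\<omega>. exp (- \<gamma> * d m (L t \<omega>)))" for m
  proof -
    define g where "g f y = u ^ nat \<lfloor>f (d m (y t)) :: real\<rfloor>" for f y :: "real \<Rightarrow> real"
    have g_meas[measurable]: "(\<lambda>(f, y). g f y) \<in> borel_measurable (?P \<Otimes>\<^sub>M ?P)"
    proof -
      have "(\<lambda>p. u ^ nat \<lfloor>(fst p) ((real (nat \<lfloor>2 ^ m * (snd p) t\<rfloor>) + 1) / 2 ^ m) :: real\<rfloor>)
          \<in> borel_measurable (?P \<Otimes>\<^sub>M ?P)"
      proof (rule measurable_compose_countable[where f = "\<lambda>j p. u ^ nat \<lfloor>(fst p) ((real j + 1) / 2 ^ m) :: real\<rfloor>"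
            and g = "\<lambda>p. nat \<lfloor>2 ^ m * (snd p) t\<rfloor>"])
        fix j :: nat
        have [measurable]: "(\<lambda>p. (fst p) ((real j + 1) / 2 ^ m)) \<in> borel_measurable (?P \<Otimes>\<^sub>M ?P)"
          by (rule measurable_compose[OF measurable_fst proj]) simp
        show "(\<lambda>p. u ^ nat \<lfloor>(fst p) ((real j + 1) / 2 ^ m) :: real\<rfloor>) \<in> borel_measurable (?P \<Otimes>\<^sub>M ?P)"
          by measurable
      next
        have [measurable]: "(\<lambda>p. (snd p) t) \<in> borel_measurable (?P \<Otimes>\<^sub>M ?P)"
          by (rule measurable_compose[OF measurable_snd proj[OF t]])
        show "(\<lambda>p. nat \<lfloor>2 ^ m * (snd p) t\<rfloor>) \<in> measurable (?P \<Otimes>\<^sub>M ?P) (count_space UNIV)"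
          by measurable
      qed
      then show ?thesis by (simp add: g_def d_def split_beta')
    qed
    interpret DX: prob_space "distr M ?P X" by (rule prob_space_distr) measurable
    interpret DY: prob_space "distr M ?P Y" by (rule prob_space_distr) measurable
    interpret D: pair_prob_space "distr M ?P X" "distr M ?P Y" ..
    have g_int: "integrable (distr M ?P X \<Otimes>\<^sub>M distr M ?P Y) (\<lambda>(f, y). g f y)"
    proof (rule D.P.integrable_const_bound[where B = 1])
      show "(\<lambda>(f, y). g f y) \<in> borel_measurable (distr M ?P X \<Otimes>\<^sub>M distr M ?P Y)"
        using g_meas by (simp cong: measurable_cong_sets)
    qed (use u_le in \<open>auto simp: g_def\<close>)
    have inner: "(\<integral>f. g f y \<partial>distr M ?P X) = exp (- \<gamma> * d m (y t))" for y
    proof -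
      have "(\<lambda>f. g f y) \<in> borel_measurable ?P"
        unfolding g_def
        by (rule measurable_compose[OF proj[OF less_imp_le[OF d_pos]], where g = "\<lambda>x. u ^ nat \<lfloor>x\<rfloor>"]) measurable
      then have "(\<integral>f. g f y \<partial>distr M ?P X) = expectation (\<lambda>\<omega>. g (X \<omega>) y)"
        by (rule integral_distr[OF X])
      also have "\<dots> = expectation (\<lambda>\<omega>. u ^ N (d m (y t)) \<omega>)"
        using d_pos by (simp add: g_def X_def less_imp_le)
      finally show ?thesis using poisson_process_pgf[OF N \<Lambda> d_pos, of u] by (simp add: \<gamma>_def)
    qed
    have "expectation (\<lambda>\<omega>. u ^ N (d m (L t \<omega>)) \<omega>) = expectation (\<lambda>\<omega>. g (X \<omega>) (Y \<omega>))"
      using d_pos by (simp add: g_def X_def Y_t less_imp_le)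
    also have "\<dots> = (\<integral>(f, y). g f y \<partial>distr M (?P \<Otimes>\<^sub>M ?P) (\<lambda>\<omega>. (X \<omega>, Y \<omega>)))"
      by (subst integral_distr) auto
    also have "\<dots> = (\<integral>(f, y). g f y \<partial>(distr M ?P X \<Otimes>\<^sub>M distr M ?P Y))"
      using XY by (simp add: indep_var_distribution_eq)
    also have "\<dots> = (\<integral>y. (\<integral>f. g f y \<partial>distr M ?P X) \<partial>distr M ?P Y)"
      by (rule D.integral_snd[OF g_int, symmetric])
    also have "\<dots> = expectation (\<lambda>\<omega>. exp (- \<gamma> * d m (Y \<omega> t)))"
      unfolding inner
    proof (rule integral_distr[OF Y])
      show "(\<lambda>y. exp (- \<gamma> * d m (y t))) \<in> borel_measurable ?P"
        by (rule measurable_compose[OF proj[OF t], where g = "\<lambda>x. exp (- \<gamma> * d m x)"])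
          (unfold d_def, measurable)
    qed
    finally show ?thesis by (simp add: Y_t)
  qed
  have "(\<lambda>m. expectation (\<lambda>\<omega>. u ^ N (d m (L t \<omega>)) \<omega>)) \<longlonglongrightarrow> expectation (\<lambda>\<omega>. u ^ N (L t \<omega>) \<omega>)"
  proof (rule integral_dominated_convergence[where w = "\<lambda>_. 1"])
    show "AE \<omega> in M. (\<lambda>m. u ^ N (d m (L t \<omega>)) \<omega>) \<longlonglongrightarrow> u ^ N (L t \<omega>) \<omega>"
    proof (rule AE_I2)
      fix \<omega> assume "\<omega> \<in> space M"
      from conv[OF this] show "(\<lambda>m. u ^ N (d m (L t \<omega>)) \<omega>) \<longlonglongrightarrow> u ^ N (L t \<omega>) \<omega>"
        by (intro tendsto_eventually) (auto elim: eventually_mono)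
    qed
  qed (use u_le in auto)
  moreover have "(\<lambda>m. expectation (\<lambda>\<omega>. exp (- \<gamma> * d m (L t \<omega>)))) \<longlonglongrightarrow> expectation (\<lambda>\<omega>. exp (- \<gamma> * L t \<omega>))"
  proof (rule integral_dominated_convergence[where w = "\<lambda>_. 1"])
    have "(\<lambda>m. d m (L t \<omega>)) \<longlonglongrightarrow> L t \<omega>" for \<omega>
      using dyadic_from_above[OF L_nonneg] by (simp add: filterlim_at d_def)
    then show "AE \<omega> in M. (\<lambda>m. exp (- \<gamma> * d m (L t \<omega>))) \<longlonglongrightarrow> exp (- \<gamma> * L t \<omega>)"
      by (intro AE_I2 tendsto_intros)
    show "AE \<omega> in M. norm (exp (- \<gamma> * d m (L t \<omega>))) \<le> 1" for m
      by (rule AE_I2) (use \<gamma> d_pos[of m] in \<open>simp add: less_imp_le\<close>)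
  qed (auto simp: d_def)
  ultimately show "expectation (\<lambda>\<omega>. u ^ N (L t \<omega>) \<omega>) = expectation (\<lambda>\<omega>. exp (- (\<Lambda> * (1 - u)) * L t \<omega>))"
    unfolding eq \<gamma>_def by (rule LIMSEQ_unique)
qed

section \<open>The first passage time of a sum of subordinators\<close>

text \<open>
  If \<open>k\<close> is the number of grid points \<open>\<delta>, 2\<delta>, \<dots>\<close> at which the path is still below \<open>t\<close>, then
  \<open>k\<delta> \<le> l \<le> (k + 1)\<delta>\<close>, and the geometric sum evaluates to \<open>V = q\<^sup>k\<close>. The point of \<open>V\<close> is that it is
  linear in the indicators of \<open>h(j\<delta>) < t\<close>, whose expectations are distribution functions at fixed
  times. This also avoids any joint measurability in path time and level.
\<close>

lemma first_passage_discretized: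
  fixes h :: "real \<Rightarrow> real"
  assumes mono: "mono_on {0..} h" and h0: "h 0 = 0" and unbounded: "\<And>x. \<exists>n::nat. x \<le> h (real n)"
    and t: "0 < t" and \<gamma>: "0 < \<gamma>" and \<delta>: "0 < \<delta>"
  defines "l \<equiv> Inf {s. 0 < s \<and> t \<le> h s}" and "q \<equiv> exp (- \<gamma> * \<delta>)"
    and "V \<equiv> 1 - (1 - exp (- \<gamma> * \<delta>)) * (\<Sum>j. exp (- \<gamma> * \<delta>) ^ j * (if h (real (Suc j) * \<delta>) < t then 1 else 0))"
  shows "{s. 0 < s \<and> t \<le> h s} \<noteq> {}"
    and "exp (- \<gamma> * l) \<le> V" and "q * V \<le> exp (- \<gamma> * l)"
proof -
  let ?S = "{s. 0 < s \<and> t \<le> h s}"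
  obtain n :: nat where n: "t \<le> h (real n)" using unbounded by blast
  have "n \<noteq> 0" using n h0 t by (cases n) auto
  with n show ne: "?S \<noteq> {}" by (auto intro!: exI[of _ "real n"])
  have bdd: "bdd_below ?S" by (intro bdd_belowI[of _ 0]) auto
  define k where "k = (LEAST k. t \<le> h (real (Suc k) * \<delta>))"
  obtain i :: nat where i: "real n / \<delta> \<le> real i" using real_arch_simple by blast
  have "real n \<le> real (Suc i) * \<delta>"
    using i \<delta> by (simp add: field_simps)
  then have "h (real n) \<le> h (real (Suc i) * \<delta>)"
    using \<delta> by (intro mono_onD[OF mono]) auto
  then have "t \<le> h (real (Suc i) * \<delta>)" using n by linarith
  then have k: "t \<le> h (real (Suc k) * \<delta>)"
    unfolding k_def by (rule LeastI)
  have less: "h (real (Suc j) * \<delta>) < t" if "j < k" for j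
    using not_less_Least[OF that[unfolded k_def]] by simp
  have not_less: "\<not> h (real (Suc j) * \<delta>) < t" if "k \<le> j" for j
  proof -
    have "h (real (Suc k) * \<delta>) \<le> h (real (Suc j) * \<delta>)"
      using \<delta> that by (intro mono_onD[OF mono] mult_right_mono) auto
    with k show ?thesis by simp
  qed
  have q: "0 < q" "q < 1" using \<gamma> \<delta> by (auto simp: q_def)
  have "(\<Sum>j. q ^ j * (if h (real (Suc j) * \<delta>) < t then 1 else 0)) = (\<Sum>j<k. q ^ j)"
    by (subst suminf_finite[of "{..<k}"]) (use not_less less in \<open>auto simp: not_less\<close>)
  also have "\<dots> = (1 - q ^ k) / (1 - q)"
    using q by (simp add: sum_gp_strict)
  finally have V: "V = q ^ k"
    unfolding V_def q_def[symmetric] using q by simp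
  have lower: "real k * \<delta> \<le> l"
    unfolding l_def
  proof (rule cInf_greatest[OF ne])
    fix s assume s: "s \<in> ?S"
    show "real k * \<delta> \<le> s"
    proof (rule ccontr)
      assume "\<not> ?thesis"
      then have sk: "s < real k * \<delta>" by simp
      then have "k \<noteq> 0" using s by (cases k) auto
      then obtain j where j: "k = Suc j" by (cases k) auto
      have "h s \<le> h (real k * \<delta>)"
        using s sk \<delta> by (intro mono_onD[OF mono]) auto
      also have "\<dots> < t" using less[of j] j by simp
      finally show False using s by simp
    qed
  qed
  have "l \<le> real (Suc k) * \<delta>"
    unfolding l_def using k \<delta> by (intro cInf_lower bdd) auto
  then have "exp (- \<gamma> * (real (Suc k) * \<delta>)) \<le> exp (- \<gamma> * l)"
    using \<gamma> by simp
  moreover have "exp (- \<gamma> * l) \<le> exp (- \<gamma> * (real k * \<delta>))"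
    using \<gamma> lower by simp
  moreover have "exp (- \<gamma> * (real j * \<delta>)) = q ^ j" for j
    by (simp add: q_def exp_of_nat_mult[symmetric] mult_ac)
  ultimately show "exp (- \<gamma> * l) \<le> V" "q * V \<le> exp (- \<gamma> * l)"
    unfolding V by (simp_all only: power_Suc)
qed

text \<open>
  The order \<open>1\<close> (the deterministic process \<open>t\<close>, occurring for \<open>\<nu> = 1/2\<close>) and the random case are
  defined differently; these are the properties that they share.
\<close>

lemma (in prob_space) stable_subordinator_facts:
  assumes H: "stable_subordinator M \<beta> H" and \<beta>: "0 < \<beta>" "\<beta> \<le> 1"
  shows stable_subordinator_measurable: "0 \<le> t \<Longrightarrow> H t \<in> borel_measurable M"
    and stable_subordinator_paths: "AE \<omega> in M. mono_on {0..} (\<lambda>t. H t \<omega>) \<and> H 0 \<omega> = 0"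
    and stable_subordinator_Laplace:
      "0 \<le> t \<Longrightarrow> 0 < s \<Longrightarrow> expectation (\<lambda>\<omega>. exp (- s * H t \<omega>)) = exp (- t * s powr \<beta>)"
proof -
  consider (deterministic) "\<beta> = 1" "\<And>t \<omega>. 0 \<le> t \<Longrightarrow> \<omega> \<in> space M \<Longrightarrow> H t \<omega> = t" | (random) "\<beta> \<noteq> 1"
    using H by (auto simp: stable_subordinator_def split: if_splits)
  note cases = this
  show "H t \<in> borel_measurable M" if "0 \<le> t"
    using cases
  proof cases
    case deterministic
    then have "H t \<in> borel_measurable M \<longleftrightarrow> (\<lambda>_. t) \<in> borel_measurable M"
      using that by (intro measurable_cong) auto
    then show ?thesis by simp
  qed (use H that in \<open>simp add: stable_subordinator_def levy_process_def\<close>)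
  show "AE \<omega> in M. mono_on {0..} (\<lambda>t. H t \<omega>) \<and> H 0 \<omega> = 0"
    using cases
  proof cases
    case deterministic
    then show ?thesis by (intro AE_I2) (auto simp: mono_on_def)
  qed (use H in \<open>auto simp: stable_subordinator_def levy_process_def\<close>)
  show "expectation (\<lambda>\<omega>. exp (- s * H t \<omega>)) = exp (- t * s powr \<beta>)" if "0 \<le> t" "0 < s"
    using cases
  proof cases
    case deterministic
    have "expectation (\<lambda>\<omega>. exp (- s * H t \<omega>)) = expectation (\<lambda>_. exp (- s * t))"
      using that deterministic(2) by (intro Bochner_Integration.integral_cong) auto
    then show ?thesis using deterministic(1) that by (simp add: prob_space mult.commute)
  qed (use H that in \<open>simp add: stable_subordinator_def\<close>)
qed

lemma has_bochner_integral_exp_decay: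
  fixes \<mu> z :: real
  assumes \<mu>: "0 < \<mu>"
  shows "has_bochner_integral lborel (\<lambda>t. indicator {z<..} t * exp (- \<mu> * t)) (exp (- \<mu> * z) / \<mu>)"
proof -
  have "indicator {0<..} t * (exp (- \<mu> * t) * t powr (1 - 1)) = indicator {0<..} t * exp (- \<mu> * t)" for t :: real
    by (auto simp: indicator_def)
  moreover have "Gamma 1 / \<mu> powr 1 = 1 / \<mu>" using \<mu> by simp
  ultimately have "has_bochner_integral lborel (\<lambda>t. indicator {0<..} t * exp (- \<mu> * t)) (1 / \<mu>)"
    using has_bochner_integral_powr_exp[OF zero_less_one \<mu>] by (simp only:)
  then have "has_bochner_integral lborel (\<lambda>t. indicator {0<..} (- z + 1 * t) * exp (- \<mu> * (- z + 1 * t))) (1 / \<mu> /\<^sub>R \<bar>1\<bar>)"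
    by (subst (asm) lborel_has_bochner_integral_real_affine_iff[of 1 _ _ "- z"]) auto
  from has_bochner_integral_mult_right[OF this, of "exp (- \<mu> * z)"]
  have "has_bochner_integral lborel (\<lambda>t. exp (- \<mu> * z) * (indicator {0<..} (- z + 1 * t) * exp (- \<mu> * (- z + 1 * t))))
      (exp (- \<mu> * z) / \<mu>)"
    by simp
  moreover have "exp (- \<mu> * z) * (indicator {0<..} (- z + 1 * t) * exp (- \<mu> * (- z + 1 * t)))
      = indicator {z<..} t * exp (- \<mu> * t)" for t
    by (auto simp: indicator_def exp_add[symmetric] algebra_simps)
  ultimately show ?thesis by (simp only:)
qed

text \<open>
  By Tonelli's theorem, since the integral of \<open>exp (-\<mu> t)\<close> over \<open>t > Z\<close> is \<open>exp (-\<mu> Z) / \<mu>\<close>.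
\<close>

lemma (in prob_space) Laplace_transform_of_cdf:
  assumes Z[measurable]: "Z \<in> borel_measurable M" and Z0: "AE \<omega> in M. 0 \<le> Z \<omega>" and \<mu>: "0 < \<mu>"
  shows "has_bochner_integral lborel
      (\<lambda>t. indicator {0<..} t * (exp (- \<mu> * t) * prob {\<omega> \<in> space M. Z \<omega> < t}))
      (expectation (\<lambda>\<omega>. exp (- \<mu> * Z \<omega>)) / \<mu>)"
proof (rule has_bochner_integral_nn_integral)
  interpret pair_sigma_finite lborel M ..
  have "mono (\<lambda>t. prob {\<omega> \<in> space M. Z \<omega> < t})"
    by (intro monoI finite_measure_mono) auto
  then have [measurable]: "(\<lambda>t. prob {\<omega> \<in> space M. Z \<omega> < t}) \<in> borel_measurable borel"
    by (rule borel_measurable_mono)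
  show "(\<lambda>t. indicator {0<..} t * (exp (- \<mu> * t) * prob {\<omega> \<in> space M. Z \<omega> < t})) \<in> borel_measurable lborel"
    by measurable
  show "AE t in lborel. 0 \<le> indicator {0<..} t * (exp (- \<mu> * t) * prob {\<omega> \<in> space M. Z \<omega> < t})"
    by simp
  show "0 \<le> expectation (\<lambda>\<omega>. exp (- \<mu> * Z \<omega>)) / \<mu>"
    using \<mu> by simp
  define K where "K t \<omega> = ennreal (indicator {0<..} t * exp (- \<mu> * t)) * indicator {\<omega> \<in> space M. Z \<omega> < t} \<omega>" for t \<omega>
  have K_meas: "(\<lambda>(t, \<omega>). K t \<omega>) \<in> borel_measurable (lborel \<Otimes>\<^sub>M M)"
    unfolding K_def by measurable
  have "(\<integral>\<^sup>+t. ennreal (indicator {0<..} t * (exp (- \<mu> * t) * prob {\<omega> \<in> space M. Z \<omega> < t})) \<partial>lborel)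
      = (\<integral>\<^sup>+t. \<integral>\<^sup>+\<omega>. K t \<omega> \<partial>M \<partial>lborel)"
  proof (rule nn_integral_cong)
    fix t :: real
    have "(\<integral>\<^sup>+\<omega>. K t \<omega> \<partial>M) = ennreal (indicator {0<..} t * exp (- \<mu> * t)) * ennreal (prob {\<omega> \<in> space M. Z \<omega> < t})"
      unfolding K_def by (subst nn_integral_cmult_indicator) (auto simp: emeasure_eq_measure)
    then show "ennreal (indicator {0<..} t * (exp (- \<mu> * t) * prob {\<omega> \<in> space M. Z \<omega> < t})) = (\<integral>\<^sup>+\<omega>. K t \<omega> \<partial>M)"
      by (simp add: ennreal_mult[symmetric] mult.assoc)
  qed
  also have "\<dots> = (\<integral>\<^sup>+\<omega>. \<integral>\<^sup>+t. K t \<omega> \<partial>lborel \<partial>M)"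
    by (rule Fubini'[OF K_meas, symmetric])
  also have "\<dots> = (\<integral>\<^sup>+\<omega>. ennreal (exp (- \<mu> * Z \<omega>) / \<mu>) \<partial>M)"
  proof (rule nn_integral_cong_AE)
    show "AE \<omega> in M. (\<integral>\<^sup>+t. K t \<omega> \<partial>lborel) = ennreal (exp (- \<mu> * Z \<omega>) / \<mu>)"
      using Z0 AE_space
    proof eventually_elim
      case (elim \<omega>)
      have "(\<integral>\<^sup>+t. ennreal (indicator {Z \<omega><..} t * exp (- \<mu> * t)) \<partial>lborel) = ennreal (exp (- \<mu> * Z \<omega>) / \<mu>)"
        using has_bochner_integral_exp_decay[OF \<mu>, of "Z \<omega>"]
        by (subst nn_integral_eq_integral) (auto simp: has_bochner_integral_iff)
      moreover have "K t \<omega> = ennreal (indicator {Z \<omega><..} t * exp (- \<mu> * t))" for t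
        using elim by (auto simp: K_def indicator_def)
      ultimately show ?case by simp
    qed
  qed
  also have "\<dots> = ennreal (expectation (\<lambda>\<omega>. exp (- \<mu> * Z \<omega>) / \<mu>))"
  proof (rule nn_integral_eq_integral)
    have "AE \<omega> in M. norm (exp (- \<mu> * Z \<omega>) / \<mu>) \<le> 1 / \<mu>"
      using Z0 by eventually_elim (use \<mu> in \<open>simp add: divide_right_mono\<close>)
    then show "integrable M (\<lambda>\<omega>. exp (- \<mu> * Z \<omega>) / \<mu>)"
      by (rule integrable_const_bound) measurable
  qed (use \<mu> in simp)
  finally show "(\<integral>\<^sup>+t. ennreal (indicator {0<..} t * (exp (- \<mu> * t) * prob {\<omega> \<in> space M. Z \<omega> < t})) \<partial>lborel)
      = ennreal (expectation (\<lambda>\<omega>. exp (- \<mu> * Z \<omega>)) / \<mu>)"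
    by simp
qed

text \<open>
  The measurability hypothesis is met whenever the inverse process is independent of another
  process, since independence presupposes random variables.
\<close>

locale subordinator_sum = prob_space M for M :: "'a measure" +
  fixes \<nu> lam :: real and H1 H2 :: "real \<Rightarrow> 'a \<Rightarrow> real"
  assumes \<nu>: "0 < \<nu>" "\<nu> \<le> 1 / 2" and lam: "0 < lam"
    and H1: "stable_subordinator M (2 * \<nu>) H1" and H2: "stable_subordinator M \<nu> H2"
    and indep: "independent_processes M H1 H2"
    and L_measurable[measurable]: "\<And>t. 0 \<le> t \<Longrightarrow> inverse_process \<nu> lam H1 H2 t \<in> borel_measurable M"
begin

definition H :: "real \<Rightarrow> 'a \<Rightarrow> real" where
  "H s \<omega> = H1 s \<omega> + (2 * lam) powr (1 / \<nu>) * H2 s \<omega>"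

text \<open>
  The Laplace exponent of \<open>H\<close>.
\<close>

definition \<phi> :: "real \<Rightarrow> real" where
  "\<phi> \<mu> = \<mu> powr (2 * \<nu>) + 2 * lam * \<mu> powr \<nu>"

abbreviation "L \<equiv> inverse_process \<nu> lam H1 H2"

lemma \<phi>_pos: "0 < \<mu> \<Longrightarrow> 0 < \<phi> \<mu>"
  using lam by (simp add: \<phi>_def add_pos_pos)

lemma H_measurable[measurable]: "0 \<le> s \<Longrightarrow> H s \<in> borel_measurable M"
  using stable_subordinator_measurable[OF H1] stable_subordinator_measurable[OF H2] \<nu>
  unfolding H_def[abs_def] by (intro borel_measurable_add borel_measurable_times) auto

lemma H_mono: "AE \<omega> in M. mono_on {0..} (\<lambda>s. H s \<omega>) \<and> H 0 \<omega> = 0"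
proof -
  have "AE \<omega> in M. mono_on {0..} (\<lambda>t. H1 t \<omega>) \<and> H1 0 \<omega> = 0"
    and "AE \<omega> in M. mono_on {0..} (\<lambda>t. H2 t \<omega>) \<and> H2 0 \<omega> = 0"
    using stable_subordinator_paths[OF H1] stable_subordinator_paths[OF H2] \<nu> by auto
  then show ?thesis
    by eventually_elim (auto simp: H_def mono_on_def intro!: add_mono mult_left_mono)
qed

lemma H_nonneg:
  assumes "0 \<le> s"
  shows "AE \<omega> in M. 0 \<le> H s \<omega>"
  using H_mono
proof eventually_elim
  case (elim \<omega>)
  then show ?case using mono_onD[of "{0..}" "\<lambda>s. H s \<omega>" 0 s] assms by simp
qed

lemma H_Laplace:
  assumes s: "0 \<le> s" and \<mu>: "0 < \<mu>"
  shows "expectation (\<lambda>\<omega>. exp (- \<mu> * H s \<omega>)) = exp (- s * \<phi> \<mu>)"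
proof -
  define c where "c = (2 * lam) powr (1 / \<nu>)"
  have H_eq: "H s \<omega> = H1 s \<omega> + c * H2 s \<omega>" for \<omega> by (simp add: H_def c_def)
  have c: "0 < c" "c powr \<nu> = 2 * lam"
    using lam \<nu> by (auto simp: c_def powr_powr)
  let ?P = "Pi\<^sub>M {0..} (\<lambda>_. borel) :: (real \<Rightarrow> real) measure"
  have proj: "(\<lambda>f. f s) \<in> borel_measurable ?P"
    using s by (intro measurable_component_singleton) auto
  have e: "(\<lambda>f. exp (- k * f s)) \<in> borel_measurable ?P" for k
    by (rule measurable_compose[OF proj, where g = "\<lambda>x. exp (- k * x)"]) measurable
  have "indep_var borel ((\<lambda>f. exp (- \<mu> * f s)) \<circ> (\<lambda>\<omega>. \<lambda>t\<in>{0..}. H1 t \<omega>))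
                  borel ((\<lambda>f. exp (- (\<mu> * c) * f s)) \<circ> (\<lambda>\<omega>. \<lambda>t\<in>{0..}. H2 t \<omega>))"
    using indep unfolding independent_processes_def by (rule indep_var_compose) (rule e)+
  then have iv: "indep_var borel (\<lambda>\<omega>. exp (- \<mu> * H1 s \<omega>)) borel (\<lambda>\<omega>. exp (- (\<mu> * c) * H2 s \<omega>))"
    using s by (simp add: comp_def)
  have E1: "expectation (\<lambda>\<omega>. exp (- \<mu> * H1 s \<omega>)) = exp (- s * \<mu> powr (2 * \<nu>))"
    using stable_subordinator_Laplace[OF H1] \<nu> s \<mu> by simp
  have E2: "expectation (\<lambda>\<omega>. exp (- (\<mu> * c) * H2 s \<omega>)) = exp (- s * (2 * lam * \<mu> powr \<nu>))"
    using stable_subordinator_Laplace[OF H2, of s "\<mu> * c"] \<nu> s \<mu> c by (simp add: powr_mult mult_ac)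
  have i1: "integrable M (\<lambda>\<omega>. exp (- \<mu> * H1 s \<omega>))"
    by (rule ccontr) (use E1 not_integrable_integral_eq in force)
  have i2: "integrable M (\<lambda>\<omega>. exp (- (\<mu> * c) * H2 s \<omega>))"
    by (rule ccontr) (use E2 not_integrable_integral_eq in force)
  have "expectation (\<lambda>\<omega>. exp (- \<mu> * H s \<omega>)) = expectation (\<lambda>\<omega>. exp (- \<mu> * H1 s \<omega>) * exp (- (\<mu> * c) * H2 s \<omega>))"
    by (simp add: H_eq exp_add[symmetric] algebra_simps)
  also have "\<dots> = expectation (\<lambda>\<omega>. exp (- \<mu> * H1 s \<omega>)) * expectation (\<lambda>\<omega>. exp (- (\<mu> * c) * H2 s \<omega>))"
    by (rule indep_var_lebesgue_integral[OF iv i1 i2])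
  also have "\<dots> = exp (- s * \<phi> \<mu>)"
    unfolding E1 E2 by (simp add: \<phi>_def exp_add[symmetric] algebra_simps)
  finally show ?thesis .
qed

text \<open>
  \<open>P(H(n) < m) \<le> exp (m) E exp (-H(n))\<close>, which tends to \<open>0\<close> as \<open>n\<close> grows. So almost every path reaches
  every level.
\<close>

lemma H_unbounded: "AE \<omega> in M. \<forall>x. \<exists>n::nat. x \<le> H (real n) \<omega>"
proof -
  have "AE \<omega> in M. \<exists>n::nat. real m \<le> H (real n) \<omega>" for m :: nat
  proof -
    define B where "B = {\<omega> \<in> space M. \<forall>n::nat. H (real n) \<omega> < real m}"
    have B[measurable]: "B \<in> sets M" unfolding B_def by measurable
    have bound: "prob B \<le> exp (real m) * exp (- \<phi> 1) ^ n" for n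
    proof -
      have i: "integrable M (\<lambda>\<omega>. exp (- 1 * H (real n) \<omega>))"
        by (rule ccontr) (use H_Laplace[of "real n" 1] not_integrable_integral_eq in force)
      have "prob B = expectation (indicator B)" by simp
      also have "\<dots> \<le> expectation (\<lambda>\<omega>. exp (real m) * exp (- 1 * H (real n) \<omega>))"
      proof (rule integral_mono)
        show "integrable M (indicator B :: 'a \<Rightarrow> real)" by (simp add: emeasure_eq_measure)
        show "integrable M (\<lambda>\<omega>. exp (real m) * exp (- 1 * H (real n) \<omega>))"
          using i by (rule integrable_mult_right)
        show "indicator B \<omega> \<le> exp (real m) * exp (- 1 * H (real n) \<omega>)" if "\<omega> \<in> space M" for \<omega>
        proof (cases "\<omega> \<in> B")
          case True
          then have "0 \<le> real m + - 1 * H (real n) \<omega>" by (auto simp: B_def intro: less_imp_le)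
          then show ?thesis using True unfolding exp_add[symmetric] by simp
        qed simp
      qed
      also have "\<dots> = exp (real m) * exp (- \<phi> 1) ^ n"
        using H_Laplace[of "real n" 1] by (simp add: exp_of_nat_mult[symmetric])
      finally show ?thesis .
    qed
    have "(\<lambda>n. exp (real m) * exp (- \<phi> 1) ^ n) \<longlonglongrightarrow> exp (real m) * 0"
      using \<phi>_pos[of 1] by (intro tendsto_mult tendsto_const LIMSEQ_power_zero) simp
    then have "prob B \<le> exp (real m) * 0"
      by (rule tendsto_lowerbound) (intro always_eventually allI bound, simp)
    then have "prob B = 0" by (simp add: measure_le_0_iff)
    then have "AE \<omega> in M. \<omega> \<notin> B"
      by (subst prob_eq_0[symmetric]) auto
    then show ?thesis
      using AE_space by eventually_elim (auto simp: B_def not_less)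
  qed
  then have "AE \<omega> in M. \<forall>m::nat. \<exists>n::nat. real m \<le> H (real n) \<omega>"
    by (simp add: AE_all_countable)
  then show ?thesis
    by eventually_elim (meson order_trans real_arch_simple)
qed

lemma L_eq_Inf:
  assumes "0 < t" "{s. 0 < s \<and> t \<le> H s \<omega>} \<noteq> {}"
  shows "L t \<omega> = Inf {s. 0 < s \<and> t \<le> H s \<omega>}"
  using assms unfolding inverse_process_def Let_def H_def by (subst if_not_P) auto

lemma L_nonneg: "0 \<le> L t \<omega>"
  by (auto simp: inverse_process_def Let_def intro!: cInf_greatest)

lemma integrable_exp_L:
  assumes "0 \<le> \<gamma>" "0 \<le> t"
  shows "integrable M (\<lambda>\<omega>. exp (- \<gamma> * L t \<omega>))"
proof (rule integrable_const_bound[where B = 1])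
  show "AE \<omega> in M. norm (exp (- \<gamma> * L t \<omega>)) \<le> 1"
    using assms L_nonneg by (intro AE_I2) simp
qed (use assms in measurable)

lemma laplace_fun_antimono:
  assumes \<gamma>: "0 < \<gamma>" and st: "0 < s" "s \<le> t"
  shows "laplace_fun M L \<gamma> t \<le> laplace_fun M L \<gamma> s"
  unfolding laplace_fun_def
proof (rule integral_mono_AE)
  show "AE \<omega> in M. exp (- \<gamma> * L t \<omega>) \<le> exp (- \<gamma> * L s \<omega>)"
    using H_mono H_unbounded
  proof eventually_elim
    case (elim \<omega>)
    have ne: "{u. 0 < u \<and> r \<le> H u \<omega>} \<noteq> {}" if "0 < r" for r
      using first_passage_discretized(1)[of "\<lambda>s. H s \<omega>" r 1 1] elim that by auto
    have "Inf {u. 0 < u \<and> s \<le> H u \<omega>} \<le> Inf {u. 0 < u \<and> t \<le> H u \<omega>}"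
      using ne[of t] st by (intro cInf_superset_mono) (auto intro!: bdd_belowI[of _ 0])
    then have "L s \<omega> \<le> L t \<omega>"
      using L_eq_Inf ne st by simp
    then show ?case using \<gamma> by simp
  qed
qed (use assms integrable_exp_L[of \<gamma> t] integrable_exp_L[of \<gamma> s] in simp_all)

text \<open>
  The expectation of the grid approximation \<open>V\<close> of \<open>exp (-\<gamma> L(t))\<close> in \<open>first_passage_discretized\<close>.
\<close>

definition discretized_laplace :: "real \<Rightarrow> real \<Rightarrow> real \<Rightarrow> real" where
  "discretized_laplace \<gamma> \<delta> t =
     1 - (1 - exp (- \<gamma> * \<delta>)) * (\<Sum>j. exp (- \<gamma> * \<delta>) ^ j * prob {\<omega> \<in> space M. H (real (Suc j) * \<delta>) \<omega> < t})"

lemma laplace_fun_discretized: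
  assumes \<gamma>: "0 < \<gamma>" and \<delta>: "0 < \<delta>" and t: "0 < t"
  shows "laplace_fun M L \<gamma> t \<le> discretized_laplace \<gamma> \<delta> t"
    and "exp (- \<gamma> * \<delta>) * discretized_laplace \<gamma> \<delta> t \<le> laplace_fun M L \<gamma> t"
proof -
  define q where "q = exp (- \<gamma> * \<delta>)"
  have q: "0 < q" "q < 1" using \<gamma> \<delta> by (auto simp: q_def)
  define g where "g j \<omega> = q ^ j * (if H (real (Suc j) * \<delta>) \<omega> < t then 1 else 0)" for j \<omega>
  define V where "V \<omega> = 1 - (1 - q) * (\<Sum>j. g j \<omega>)" for \<omega>
  have Hm[measurable]: "H (real (Suc j) * \<delta>) \<in> borel_measurable M" for j
    using \<delta> by (intro H_measurable) auto
  have g_bound: "norm (g j \<omega>) \<le> q ^ j" for j \<omega>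
    using q by (simp add: g_def)
  have g_int: "integrable M (g j)" for j
  proof (rule integrable_const_bound[where B = "q ^ j"])
    show "g j \<in> borel_measurable M" unfolding g_def[abs_def] by measurable
  qed (use g_bound in simp)
  have geo: "summable (\<lambda>j. q ^ j)" using q by (intro summable_geometric) simp
  have sn: "summable (\<lambda>j. norm (g j \<omega>))" for \<omega>
    by (rule summable_comparison_test[OF _ geo]) (use g_bound in auto)
  have "(\<integral>\<omega>. norm (g j \<omega>) \<partial>M) \<le> q ^ j" for j
    using integral_mono[OF integrable_norm[OF g_int] integrable_const[of "q ^ j"] g_bound] by (simp add: prob_space)
  then have si: "summable (\<lambda>j. \<integral>\<omega>. norm (g j \<omega>) \<partial>M)"
    by (intro summable_comparison_test[OF _ geo]) auto
  have "(\<integral>\<omega>. g j \<omega> \<partial>M) = q ^ j * prob {\<omega> \<in> space M. H (real (Suc j) * \<delta>) \<omega> < t}" for j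
  proof -
    have "(\<integral>\<omega>. g j \<omega> \<partial>M) = (\<integral>\<omega>. q ^ j * indicator {\<omega> \<in> space M. H (real (Suc j) * \<delta>) \<omega> < t} \<omega> \<partial>M)"
      by (intro Bochner_Integration.integral_cong) (auto simp: g_def)
    also have "\<dots> = q ^ j * prob ({\<omega> \<in> space M. H (real (Suc j) * \<delta>) \<omega> < t} \<inter> space M)"
      by simp
    also have "{\<omega> \<in> space M. H (real (Suc j) * \<delta>) \<omega> < t} \<inter> space M = {\<omega> \<in> space M. H (real (Suc j) * \<delta>) \<omega> < t}"
      by auto
    finally show ?thesis .
  qed
  then have V: "integrable M V" "expectation V = discretized_laplace \<gamma> \<delta> t"
    unfolding discretized_laplace_def q_def[symmetric]
    using integrable_suminf[OF g_int _ si] integral_suminf[OF g_int _ si] sn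
    by (simp_all add: V_def[abs_def] prob_space)
  have bounds: "AE \<omega> in M. exp (- \<gamma> * L t \<omega>) \<le> V \<omega> \<and> q * V \<omega> \<le> exp (- \<gamma> * L t \<omega>)"
    using H_mono H_unbounded
  proof eventually_elim
    case (elim \<omega>)
    note path = first_passage_discretized[of "\<lambda>s. H s \<omega>" t \<gamma> \<delta>]
    have "L t \<omega> = Inf {s. 0 < s \<and> t \<le> H s \<omega>}"
      using path(1) elim t \<gamma> \<delta> by (intro L_eq_Inf) auto
    then show ?case
      using path(2,3) elim t \<gamma> \<delta> by (simp add: V_def g_def q_def)
  qed
  note E = integrable_exp_L[of \<gamma> t]
  show "laplace_fun M L \<gamma> t \<le> discretized_laplace \<gamma> \<delta> t"
    unfolding laplace_fun_def V(2)[symmetric]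
    by (rule integral_mono_AE) (use E V \<gamma> t bounds in \<open>auto elim: AE_mp\<close>)
  have "expectation (\<lambda>\<omega>. q * V \<omega>) \<le> laplace_fun M L \<gamma> t"
    unfolding laplace_fun_def
    by (rule integral_mono_AE) (use E V \<gamma> t bounds in \<open>auto elim: AE_mp\<close>)
  then show "exp (- \<gamma> * \<delta>) * discretized_laplace \<gamma> \<delta> t \<le> laplace_fun M L \<gamma> t"
    using V by (simp add: q_def)
qed

lemma discretized_laplace_Laplace:
  assumes \<gamma>: "0 < \<gamma>" and \<delta>: "0 < \<delta>" and \<mu>: "0 < \<mu>"
  shows "has_bochner_integral lborel (\<lambda>t. indicator {0<..} t * (exp (- \<mu> * t) * discretized_laplace \<gamma> \<delta> t))
     ((1 - exp (- \<delta> * \<phi> \<mu>)) / (1 - exp (- \<delta> * (\<gamma> + \<phi> \<mu>))) / \<mu>)"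
proof -
  define q where "q = exp (- \<gamma> * \<delta>)"
  define p where "p = exp (- \<delta> * \<phi> \<mu>)"
  have q: "0 < q" "q < 1" using \<gamma> \<delta> by (auto simp: q_def)
  have p: "0 < p" "p < 1" using \<phi>_pos[OF \<mu>] \<delta> by (auto simp: p_def)
  have qp: "q * p < 1" using q p mult_strict_mono[of q 1 p 1] by simp
  define e where "e t = indicator {0<..} t * exp (- \<mu> * t)" for t
  define F where "F j t = prob {\<omega> \<in> space M. H (real (Suc j) * \<delta>) \<omega> < t}" for j t
  have e0: "0 \<le> e t" for t by (simp add: e_def)
  have e_int: "has_bochner_integral lborel e (1 / \<mu>)"
    using has_bochner_integral_exp_decay[OF \<mu>, of 0] by (simp add: e_def[abs_def])
  have F_int: "has_bochner_integral lborel (\<lambda>t. q ^ j * (e t * F j t)) ((q * p) ^ j * (p / \<mu>))" for j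
  proof -
    have s: "0 \<le> real (Suc j) * \<delta>" using \<delta> by simp
    have p_power: "exp (- (real (Suc j) * \<delta>) * \<phi> \<mu>) = p ^ Suc j"
      by (simp add: p_def exp_of_nat_mult[symmetric] mult_ac del: power_Suc of_nat_Suc)
    have "q ^ j * (expectation (\<lambda>\<omega>. exp (- \<mu> * H (real (Suc j) * \<delta>) \<omega>)) / \<mu>) = (q * p) ^ j * (p / \<mu>)"
      unfolding H_Laplace[OF s \<mu>] p_power by (simp add: power_mult_distrib)
    then show ?thesis
      using has_bochner_integral_mult_right[OF Laplace_transform_of_cdf[OF H_measurable[OF s] H_nonneg[OF s] \<mu>], of "q ^ j"]
      by (simp only: e_def F_def mult.assoc)
  qed
  have geo: "summable (\<lambda>j. (q * p) ^ j)" using q p qp by (intro summable_geometric) simp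
  have g0: "0 \<le> q ^ j * (e t * F j t)" for j t
    using q e0 by (simp add: F_def)
  have sF: "summable (\<lambda>j. q ^ j * F j t)" for t
  proof (rule summable_comparison_test)
    show "summable (\<lambda>j. q ^ j)" using q by (intro summable_geometric) simp
    show "\<exists>N. \<forall>n\<ge>N. norm (q ^ n * F n t) \<le> q ^ n"
      using q by (auto simp: F_def abs_mult intro!: mult_left_le exI[of _ 0])
  qed
  have int: "integrable lborel (\<lambda>t. q ^ j * (e t * F j t))" for j
    using F_int by (auto simp: has_bochner_integral_iff)
  have sn: "summable (\<lambda>j. norm (q ^ j * (e t * F j t)))" for t
    using summable_mult[OF sF[of t], of "e t"] g0 by (simp add: mult_ac)
  have si: "summable (\<lambda>j. \<integral>t. norm (q ^ j * (e t * F j t)) \<partial>lborel)"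
    using F_int summable_mult2[OF geo, of "p / \<mu>"] g0 by (simp add: has_bochner_integral_iff)
  have "(\<Sum>j. (q * p) ^ j * (p / \<mu>)) = 1 / (1 - q * p) * (p / \<mu>)"
    using suminf_mult2[OF geo, of "p / \<mu>"] suminf_geometric[of "q * p"] q p qp by simp
  then have "has_bochner_integral lborel (\<lambda>t. \<Sum>j. q ^ j * (e t * F j t)) (1 / (1 - q * p) * (p / \<mu>))"
    using integrable_suminf[OF int _ si] integral_suminf[OF int _ si] sn F_int
    by (simp add: has_bochner_integral_iff)
  then have "has_bochner_integral lborel (\<lambda>t. e t - (1 - q) * (\<Sum>j. q ^ j * (e t * F j t)))
      (1 / \<mu> - (1 - q) * (1 / (1 - q * p) * (p / \<mu>)))"
    by (intro has_bochner_integral_diff has_bochner_integral_mult_right e_int)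
  moreover have "e t - (1 - q) * (\<Sum>j. q ^ j * (e t * F j t))
      = indicator {0<..} t * (exp (- \<mu> * t) * discretized_laplace \<gamma> \<delta> t)" for t
  proof -
    have sum_e: "(\<Sum>j. q ^ j * (e t * F j t)) = e t * (\<Sum>j. q ^ j * F j t)"
      using suminf_mult[OF sF[of t], of "e t"] by (simp add: mult.left_commute)
    have D: "discretized_laplace \<gamma> \<delta> t = 1 - (1 - q) * (\<Sum>j. q ^ j * F j t)"
      unfolding discretized_laplace_def q_def F_def ..
    show ?thesis unfolding sum_e D by (simp add: e_def algebra_simps)
  qed
  moreover have "1 / \<mu> - (1 - q) * (1 / (1 - q * p) * (p / \<mu>)) = (1 - p) / (1 - q * p) / \<mu>"
    using qp \<mu> by (simp add: field_simps)
  moreover have "q * p = exp (- \<delta> * (\<gamma> + \<phi> \<mu>))"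
    by (simp add: q_def p_def exp_add[symmetric] algebra_simps)
  ultimately show ?thesis by (simp only: p_def)
qed

text \<open>
  The grid bounds, integrated against \<open>exp (-\<mu> t)\<close>, trap the transform; both tend to the same limit
  as \<open>\<delta>\<close> tends to \<open>0\<close>. Monotonicity in \<open>t\<close> provides the measurability of the integrand.
\<close>

lemma laplace_fun_Laplace:
  assumes \<gamma>: "0 < \<gamma>" and \<mu>: "0 < \<mu>"
  shows "has_bochner_integral lborel (\<lambda>t. indicator {0<..} t * (exp (- \<mu> * t) * laplace_fun M L \<gamma> t))
     (\<phi> \<mu> / (\<gamma> + \<phi> \<mu>) / \<mu>)"
proof -
  define l where "l t = indicator {0<..} t * (exp (- \<mu> * t) * laplace_fun M L \<gamma> t)" for t
  define X where "X \<delta> t = indicator {0<..} t * (exp (- \<mu> * t) * discretized_laplace \<gamma> \<delta> t)" for \<delta> t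
  define I where "I \<delta> = (1 - exp (- \<delta> * \<phi> \<mu>)) / (1 - exp (- \<delta> * (\<gamma> + \<phi> \<mu>))) / \<mu>" for \<delta>
  have X: "has_bochner_integral lborel (X \<delta>) (I \<delta>)" if "0 < \<delta>" for \<delta>
    using discretized_laplace_Laplace[OF \<gamma> that \<mu>] by (simp add: X_def[abs_def] I_def)
  have l_le: "l t \<le> X \<delta> t" and le_l: "exp (- \<gamma> * \<delta>) * X \<delta> t \<le> l t" if "0 < \<delta>" for \<delta> t
    using laplace_fun_discretized[OF \<gamma> that, of t]
    by (auto simp: l_def X_def indicator_def mult.left_commute[of "exp (- (\<gamma> * \<delta>))"] intro!: mult_left_mono)
  have l0: "0 \<le> l t" for t by (simp add: l_def laplace_fun_def)
  have "mono_on {0<..} (\<lambda>t. - laplace_fun M L \<gamma> t)"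
    using laplace_fun_antimono[OF \<gamma>] by (auto simp: mono_on_def)
  from borel_measurable_mono_on_fnc[OF this]
  have "(\<lambda>t. - (- laplace_fun M L \<gamma> t)) \<in> borel_measurable (restrict_space borel {0<..})"
    by (rule borel_measurable_uminus)
  then have "(\<lambda>t. laplace_fun M L \<gamma> t * indicator {0<..} t) \<in> borel_measurable borel"
    by (subst (asm) borel_measurable_restrict_space_iff) (simp_all add: mult.commute)
  from borel_measurable_times[OF _ this, of "\<lambda>t. exp (- \<mu> * t)"]
  have "(\<lambda>t. exp (- \<mu> * t) * (laplace_fun M L \<gamma> t * indicator {0<..} t)) \<in> borel_measurable borel"
    by measurable
  moreover have "exp (- \<mu> * t) * (laplace_fun M L \<gamma> t * indicator {0<..} t) = l t" for t
    by (simp add: l_def)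
  ultimately have l_meas: "l \<in> borel_measurable lborel"
    by simp
  have l_int: "integrable lborel l"
    by (rule Bochner_Integration.integrable_bound[of lborel "X 1"])
      (use X[of 1] l_meas l_le[of 1] l0 in \<open>auto simp: has_bochner_integral_iff intro!: AE_I2 order_trans[OF l_le[of 1] abs_ge_self]\<close>)
  have "(\<integral>t. l t \<partial>lborel) \<le> I \<delta>" and "exp (- \<gamma> * \<delta>) * I \<delta> \<le> (\<integral>t. l t \<partial>lborel)" if "0 < \<delta>" for \<delta>
  proof -
    have Xi: "integrable lborel (X \<delta>)" "(\<integral>t. X \<delta> t \<partial>lborel) = I \<delta>"
      using X[OF that] by (auto simp: has_bochner_integral_iff)
    show "(\<integral>t. l t \<partial>lborel) \<le> I \<delta>"
      unfolding Xi(2)[symmetric] using Xi(1) l_int l_le[OF that] by (intro integral_mono) auto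
    have "(\<integral>t. exp (- \<gamma> * \<delta>) * X \<delta> t \<partial>lborel) \<le> (\<integral>t. l t \<partial>lborel)"
      using Xi(1) l_int le_l[OF that] by (intro integral_mono) auto
    then show "exp (- \<gamma> * \<delta>) * I \<delta> \<le> (\<integral>t. l t \<partial>lborel)"
      using Xi by simp
  qed
  note bounds = this
  have pos: "0 < \<phi> \<mu>" using \<phi>_pos[OF \<mu>] .
  have "(I \<longlongrightarrow> \<phi> \<mu> * inverse (\<phi> \<mu> + \<gamma>) * inverse \<mu>) (at_right 0)"
    unfolding I_def using pos \<gamma> \<mu> by real_asymp
  then have I_lim: "(I \<longlongrightarrow> \<phi> \<mu> / (\<gamma> + \<phi> \<mu>) / \<mu>) (at_right 0)"
    by (simp add: divide_inverse add.commute)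
  have e_lim: "((\<lambda>\<delta>. exp (- \<gamma> * \<delta>)) \<longlongrightarrow> 1) (at_right 0)"
    by real_asymp
  have ev: "\<forall>\<^sub>F \<delta> in at_right 0. 0 < (\<delta>::real)"
    by (simp add: eventually_at_right_less)
  have "(\<integral>t. l t \<partial>lborel) \<le> \<phi> \<mu> / (\<gamma> + \<phi> \<mu>) / \<mu>"
    by (rule tendsto_lowerbound[OF I_lim]) (use ev bounds(1) in \<open>auto elim: eventually_mono\<close>)
  moreover have "1 * (\<phi> \<mu> / (\<gamma> + \<phi> \<mu>) / \<mu>) \<le> (\<integral>t. l t \<partial>lborel)"
    by (rule tendsto_upperbound[OF tendsto_mult[OF e_lim I_lim]]) (use ev bounds(2) in \<open>auto elim: eventually_mono\<close>)
  ultimately show ?thesis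
    using l_int by (simp add: has_bochner_integral_iff l_def[abs_def])
qed

text \<open>
  The degenerate value \<open>\<gamma> = 0\<close> is separate because the geometric weights of the grid approximation
  need \<open>q < 1\<close>; it corresponds to the generating function at \<open>u = 1\<close>.
\<close>

lemma laplace_fun_eq_frac_series:
  assumes \<gamma>: "0 \<le> \<gamma>" and t: "0 \<le> t"
  shows "laplace_fun M L \<gamma> t = frac_series \<nu> (relax_coeff lam \<gamma>) t"
proof -
  note bound = relax_coeff_bound[OF less_imp_le[OF lam] \<gamma>]
  consider (start) "t = 0" | (trivial) "\<gamma> = 0" | (main) "0 < t" "0 < \<gamma>"
    using \<gamma> t by linarith
  then show ?thesis
  proof cases
    case start
    then show ?thesis
      using frac_series_zero[OF \<nu>(1) bound] by (simp add: laplace_fun_def inverse_process_def prob_space)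
  next
    case trivial
    have "relax_coeff lam 0 (Suc n) = 0" for n
      by (induction n) auto
    then have "relax_coeff lam 0 n = 0" if "n \<noteq> 0" for n
      using that by (cases n) auto
    then have "frac_series \<nu> (relax_coeff lam 0) t = 1"
      unfolding frac_series_def by (subst suminf_finite[of "{0}"]) auto
    then show ?thesis using trivial by (simp add: laplace_fun_def prob_space)
  next
    case main
    define K where "K = 1 + 2 * lam + \<gamma>"
    have K: "0 < K" using lam \<gamma> by (simp add: K_def)
    \<comment> \<open>From \<open>\<alpha>\<close> on, \<open>\<mu>\<^bsup>\<nu>\<^esup>\<close> exceeds the growth rate \<open>K\<close> of the coefficients.\<close>
    define \<alpha> where "\<alpha> = (K + 1) powr (1 / \<nu>)"
    have \<alpha>: "0 < \<alpha>" "\<alpha> powr \<nu> = K + 1" using K \<nu> by (auto simp: \<alpha>_def powr_powr)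
    show ?thesis
    proof (rule Laplace_unique_antimono_continuous[where l = "laplace_fun M L \<gamma>" and
          f = "frac_series \<nu> (relax_coeff lam \<gamma>)" and \<alpha> = \<alpha> and I = "\<lambda>\<mu>. \<phi> \<mu> / (\<gamma> + \<phi> \<mu>) / \<mu>"])
      show "isCont (frac_series \<nu> (relax_coeff lam \<gamma>)) t" if "0 < t" for t
        using frac_series_has_derivative[OF \<nu>(1) bound that] by (rule DERIV_isCont)
      fix \<mu> assume "\<alpha> \<le> \<mu>"
      then have \<mu>: "0 < \<mu>" using \<alpha> by simp
      have "K + 1 \<le> \<mu> powr \<nu>"
        using powr_mono2[OF less_imp_le[OF \<nu>(1)] less_imp_le[OF \<alpha>(1)] \<open>\<alpha> \<le> \<mu>\<close>] \<alpha> by simp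
      then have K\<mu>: "K < \<mu> powr \<nu>" by simp
      show "has_bochner_integral lborel (\<lambda>t. indicator {0<..} t * (exp (- \<mu> * t) * laplace_fun M L \<gamma> t))
          (\<phi> \<mu> / (\<gamma> + \<phi> \<mu>) / \<mu>)"
        using main \<mu> by (intro laplace_fun_Laplace)
      define x where "x = \<mu> powr - \<nu>"
      have x: "0 < x" using \<mu> by (simp add: x_def)
      have x1: "\<mu> powr \<nu> * x = 1" using \<mu> by (simp add: x_def powr_add[symmetric])
      have "K * x < 1" using mult_strict_right_mono[OF K\<mu> x] x1 by simp
      then have gen: "(1 + 2 * lam * x + \<gamma> * x\<^sup>2) * (\<Sum>n. relax_coeff lam \<gamma> n * x ^ n) = 1 + 2 * lam * x"
        using x lam \<gamma> by (intro relax_coeff_generating_function) (auto simp: K_def)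
      have \<phi>x: "\<phi> \<mu> * x\<^sup>2 = 1 + 2 * lam * x"
      proof -
        have "\<mu> powr (2 * \<nu>) = (\<mu> powr \<nu>)\<^sup>2"
          using \<mu> by (simp add: power2_eq_square powr_add[symmetric])
        then have "\<phi> \<mu> * x\<^sup>2 = (\<mu> powr \<nu> * x)\<^sup>2 + 2 * lam * x * (\<mu> powr \<nu> * x)"
          by (simp add: \<phi>_def algebra_simps power2_eq_square)
        then show ?thesis by (simp add: x1)
      qed
      have "0 < \<gamma> + \<phi> \<mu>" using \<phi>_pos[OF \<mu>] \<gamma> by simp
      moreover have "(\<gamma> + \<phi> \<mu>) * x\<^sup>2 * (\<Sum>n. relax_coeff lam \<gamma> n * x ^ n) = \<phi> \<mu> * x\<^sup>2"
        using gen \<phi>x by (simp add: algebra_simps)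
      then have "(\<gamma> + \<phi> \<mu>) * (\<Sum>n. relax_coeff lam \<gamma> n * x ^ n) = \<phi> \<mu>"
        using x by simp
      ultimately have "(\<Sum>n. relax_coeff lam \<gamma> n * x ^ n) = \<phi> \<mu> / (\<gamma> + \<phi> \<mu>)"
        by (simp add: eq_divide_eq mult.commute)
      then show "has_bochner_integral lborel
          (\<lambda>t. indicator {0<..} t * (exp (- \<mu> * t) * frac_series \<nu> (relax_coeff lam \<gamma>) t))
          (\<phi> \<mu> / (\<gamma> + \<phi> \<mu>) / \<mu>)"
        using frac_series_Laplace[OF \<nu>(1) bound \<mu>] K\<mu> by (simp add: K_def x_def)
    qed (use main laplace_fun_antimono in auto)
  qed
qed

end

section \<open>The generating function\<close>

theorem theorem8:
  fixes M :: "'a measure"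
    and \<nu> lam \<Lambda> :: real
    and H1 H2 L :: "real \<Rightarrow> 'a \<Rightarrow> real"
    and N :: "real \<Rightarrow> 'a \<Rightarrow> nat"
  assumes "prob_space M"
    and "0 < \<nu>" "\<nu> \<le> 1 / 2" "0 < lam" "0 < \<Lambda>"
    and "stable_subordinator M (2 * \<nu>) H1"
    and "stable_subordinator M \<nu> H2"
    and "independent_processes M H1 H2"
    and "L = inverse_process \<nu> lam H1 H2"
    and "poisson_process M \<Lambda> N"
    and "independent_processes M (\<lambda>t \<omega>. real (N t \<omega>)) L"
  shows
    "(\<forall>u. \<bar>u\<bar> \<le> 1 \<longrightarrow>
        gen_fun M N L u 0 = 1 \<and>
        (\<forall>t>0. caputo_differentiable (2 * \<nu>) (gen_fun M N L u) t \<and>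
               caputo_differentiable \<nu> (gen_fun M N L u) t \<and>
               caputo_deriv (2 * \<nu>) (gen_fun M N L u) t
                 + 2 * lam * caputo_deriv \<nu> (gen_fun M N L u) t
                 = \<Lambda> * (u - 1) * gen_fun M N L u t)) \<and>
     (\<forall>u t. \<bar>u\<bar> \<le> 1 \<and> u < 1 \<and> 0 \<le> t \<longrightarrow>
        gen_fun M N L u t = laplace_fun M L (\<Lambda> * (1 - u)) t) \<and>
     (\<forall>\<gamma> t. \<forall>w :: complex.
        0 < \<gamma> \<and> \<gamma> \<noteq> lam\<^sup>2 \<and> 0 \<le> t \<and> w\<^sup>2 = of_real (lam\<^sup>2 - \<gamma>) \<longrightarrow>
        of_real (laplace_fun M L \<gamma> t) =
          1 / 2 * ((1 + of_real lam / w) * mittag_leffler \<nu> 1 ((- of_real lam + w) * of_real (t powr \<nu>))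
                 + (1 - of_real lam / w) * mittag_leffler \<nu> 1 ((- of_real lam - w) * of_real (t powr \<nu>)))) \<and>
     (\<Lambda> = lam\<^sup>2 \<longrightarrow>
        (\<forall>u t. \<forall>w :: complex.
          \<bar>u\<bar> \<le> 1 \<and> u < 1 \<and> u \<noteq> 0 \<and> 0 \<le> t \<and> w\<^sup>2 = of_real u \<longrightarrow>
          of_real (gen_fun M N L u t) =
            (w + 1) / (2 * w) * mittag_leffler \<nu> 1 (- of_real lam * (1 - w) * of_real (t powr \<nu>))
          + (w - 1) / (2 * w) * mittag_leffler \<nu> 1 (- of_real lam * (1 + w) * of_real (t powr \<nu>))))"
proof -
  interpret prob_space M by fact
  note \<nu> = assms(2,3) and lam = assms(4) and \<Lambda> = assms(5)
  note L_def = assms(9) and N = assms(10) and NL = assms(11)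
  have L_measurable: "L t \<in> borel_measurable M" if "0 \<le> t" for t
  proof -
    have "(\<lambda>\<omega>. \<lambda>s\<in>{0..}. L s \<omega>) \<in> measurable M (Pi\<^sub>M {0..} (\<lambda>_. borel))"
      using NL unfolding independent_processes_def by (rule indep_var_rv2)
    from measurable_compose[OF this measurable_component_singleton[of t]] that
    show ?thesis by simp
  qed
  interpret S: subordinator_sum M \<nu> lam H1 H2
    using assms L_measurable by unfold_locales auto
  have L_nonneg: "0 \<le> L t \<omega>" for t \<omega>
    using S.L_nonneg by (simp add: L_def)
  have laplace: "laplace_fun M L \<gamma> t = frac_series \<nu> (relax_coeff lam \<gamma>) t" if "0 \<le> \<gamma>" "0 \<le> t" for \<gamma> t
    using S.laplace_fun_eq_frac_series[OF that] by (simp add: L_def)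
  have gen: "gen_fun M N L u t = laplace_fun M L (\<Lambda> * (1 - u)) t" if "\<bar>u\<bar> \<le> 1" "0 \<le> t" for u t
    using poisson_process_at_random_time[OF N \<Lambda> NL that(2) L_nonneg] nat_valued_pgf that(1)
    by (simp add: gen_fun_def state_prob_def laplace_fun_def)
  have closed_form: "of_real (laplace_fun M L \<gamma> t) =
          1 / 2 * ((1 + of_real lam / w) * mittag_leffler \<nu> 1 ((- of_real lam + w) * of_real (t powr \<nu>))
                 + (1 - of_real lam / w) * mittag_leffler \<nu> 1 ((- of_real lam - w) * of_real (t powr \<nu>)))"
    if "0 < \<gamma>" "\<gamma> \<noteq> lam\<^sup>2" "0 \<le> t" "w\<^sup>2 = of_real (lam\<^sup>2 - \<gamma>)" for \<gamma> t and w :: complex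
  proof -
    have "w \<noteq> 0" using that by (auto simp flip: of_real_power)
    then show ?thesis
      using frac_series_relax_Mittag_Leffler[OF \<nu>(1) less_imp_le[OF lam] less_imp_le[OF that(1)] that(4)]
        laplace[OF less_imp_le[OF that(1)] that(3)] by simp
  qed
  have "gen_fun M N L u 0 = 1 \<and>
        (\<forall>t>0. caputo_differentiable (2 * \<nu>) (gen_fun M N L u) t \<and>
               caputo_differentiable \<nu> (gen_fun M N L u) t \<and>
               caputo_deriv (2 * \<nu>) (gen_fun M N L u) t
                 + 2 * lam * caputo_deriv \<nu> (gen_fun M N L u) t
                 = \<Lambda> * (u - 1) * gen_fun M N L u t)" if u: "\<bar>u\<bar> \<le> 1" for u
  proof -
    define \<gamma> where "\<gamma> = \<Lambda> * (1 - u)"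
    have \<gamma>: "0 \<le> \<gamma>" using u \<Lambda> by (simp add: \<gamma>_def)
    note bound = relax_coeff_bound[OF less_imp_le[OF lam] \<gamma>]
    have eq: "gen_fun M N L u s = frac_series \<nu> (relax_coeff lam \<gamma>) s" if "0 \<le> s" for s
      using gen[OF u that] laplace[OF \<gamma> that] by (simp add: \<gamma>_def)
    have "gen_fun M N L u 0 = 1"
      using eq[of 0] frac_series_zero[OF \<nu>(1) bound] by simp
    moreover have "caputo_differentiable (2 * \<nu>) (gen_fun M N L u) t"
      and "caputo_differentiable \<nu> (gen_fun M N L u) t" if "0 < t" for t
      using frac_series_Caputo(1)[OF \<nu>(1) bound eq _ _ that] \<nu> by auto
    moreover have "caputo_deriv (2 * \<nu>) (gen_fun M N L u) t + 2 * lam * caputo_deriv \<nu> (gen_fun M N L u) t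
        = \<Lambda> * (u - 1) * gen_fun M N L u t" if "0 < t" for t
      using frac_series_relax_equation[OF \<nu> less_imp_le[OF lam] \<gamma> that eq]
      by (simp add: \<gamma>_def algebra_simps)
    ultimately show ?thesis by blast
  qed
  moreover have "of_real (gen_fun M N L u t) =
            (w + 1) / (2 * w) * mittag_leffler \<nu> 1 (- of_real lam * (1 - w) * of_real (t powr \<nu>))
          + (w - 1) / (2 * w) * mittag_leffler \<nu> 1 (- of_real lam * (1 + w) * of_real (t powr \<nu>))"
    if "\<Lambda> = lam\<^sup>2" and u: "\<bar>u\<bar> \<le> 1" "u < 1" "u \<noteq> 0" and t: "0 \<le> t" and w: "w\<^sup>2 = of_real u"
    for u t and w :: complex
  proof -
    have w0: "w \<noteq> 0" using w u by auto
    \<comment> \<open>Here \<open>\<lambda>\<^sup>2 - \<Lambda> (1 - u) = \<lambda>\<^sup>2 u\<close>, so \<open>\<lambda> \<surd>u\<close> is the root required by the general formula.\<close>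
    have *: "of_real (laplace_fun M L (\<Lambda> * (1 - u)) t) =
          1 / 2 * ((1 + of_real lam / (of_real lam * w)) *
              mittag_leffler \<nu> 1 ((- of_real lam + of_real lam * w) * of_real (t powr \<nu>))
            + (1 - of_real lam / (of_real lam * w)) *
              mittag_leffler \<nu> 1 ((- of_real lam - of_real lam * w) * of_real (t powr \<nu>)))"
      using \<open>\<Lambda> = lam\<^sup>2\<close> u \<Lambda> lam t w
      by (intro closed_form) (auto simp: power_mult_distrib right_diff_distrib)
    have roots: "- of_real lam + of_real lam * w = - of_real lam * (1 - w)"
      "- of_real lam - of_real lam * w = - of_real lam * (1 + w)"
      by (simp_all add: algebra_simps)
    have weights: "1 / 2 * ((1 + of_real lam / (of_real lam * w)) * a + (1 - of_real lam / (of_real lam * w)) * b)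
        = (w + 1) / (2 * w) * a + (w - 1) / (2 * w) * b" for a b
      using w0 lam by (simp add: field_simps)
    from * show ?thesis
      unfolding gen[OF u(1) t] roots weights .
  qed
  ultimately show ?thesis
    using gen closed_form by blast
qed

end
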